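(* Let $\psi$ be a regular colouring. Then the coloured Kac-Moody algebra $U_h(\psi)$ is $\mathfrak b$-trivial. Moreover, it admits exactly one $\mathfrak b$-trivialization.
   Context: $\mathbb k$ is a field of characteristic zero, and $\mathbb k[[h]]$ is the ring of formal power series over $\mathbb k$. For a $\mathbb k$-vector space $V_0$, $V_0[[h]]$ denotes the module of formal series $\sum_{m\ge0}v_mh^m$ with $v_m\in V_0$. For a $\mathbb k[[h]]$-linear map $g$, $\bar g$ denotes the induced map modulo $h$. $\mathfrak a$ is the Lie algebra over $\mathbb k$ generated by $H,X^-,X^+$ subject to $[H,X^\pm]=\pm2X^\pm$. An $\mathfrak a$-algebra is an algebra with a structural homomorphism from $U(\mathfrak a)$. $U(\mathfrak{sl}_2)$ is an $\mathfrak a$-algebra via the canonical projection. We set $U_h(\mathfrak a):=U(\mathfrak a)[[h]]$. For a $U_h(\mathfrak a)$-algebra $A$, the quotient $A/hA$ is an $\mathfrak a$-algebra, and $U(\mathfrak{sl}_2)[[h]]/h\cong U(\mathfrak{sl}_2)$. A colouring is a sequence $\psi=(\psi^k)_{k\ge1}$ of functions $\psi^k:\mathbb Z\to\mathbb k[[h]]$ satisfying: - (C1) $\psi^k(n)\equiv k(n-k+1)\bmod h$; - (C2) $\psi^{n+1}(n)=0$ for all $n\ge0$; - (C3) $\psi^{n+k+1}(n)=\psi^k(-n-2)$ for all $k\ge1$ and all $n\ge0$. Write $\psi^k(n)=\sum_m\psi^k_m(n)h^m$. The colouring $\psi$ is regular if, for each $m$, there is $P_m\in\mathbb k[x,y]$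 with $\psi^k_m(n)=P_m(k,n)$ for all $k\ge1$ and $n\in\mathbb Z$. $V_h(n,\psi)$ is the representation of $U_h(\mathfrak a)$ on $(\bigoplus_{k\ge0}\mathbb k b_k)[[h]]$ with the following action: - $H.b_k=(n-2k)b_k$; - $X^-.b_k=b_{k+1}$; - $X^+.b_0=0$, and $X^+.b_k=\psi^k(n)b_{k-1}$ for $k\ge1$. $U_h(\psi)$ is the quotient of $U_h(\mathfrak a)$ by the two-sided ideal of elements that act by zero on all $V_h(n,\psi)$, $n\in\mathbb Z$. The images of $H,X^\pm$ in it are again denoted $H,X^\pm$. A $\mathfrak b$-trivialization of $U_h(\psi)$ is a $\mathbb k[[h]]$-algebra isomorphism $g:U(\mathfrak{sl}_2)[[h]]\to U_h(\psi)$ such that $g(H)=H$, $g(X^-)=X^-$, and $\bar g:U(\mathfrak{sl}_2)\to U_h(\psi)/hU_h(\psi)$ is an isomorphism of $\mathfrak a$-algebras. $U_h(\psi)$ is $\mathfrak b$-trivial if it admits a $\mathfrak b$-trivialization. *)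

theory Defs
  imports "HOL-Algebra.QuotRing" "HOL-Computational_Algebra.Formal_Power_Series"
          "HOL-Computational_Algebra.Polynomial"
begin

datatype agen = GH | GXm | GXp

text \<open>Elements of the free algebra: finitely supported coefficient functions on words.
  The word [g1,...,gr] stands for the product g1 * ... * gr.\<close>

definition fword :: "agen list \<Rightarrow> agen list \<Rightarrow> 'k::field" where
  "fword w = (\<lambda>w'. if w' = w then 1 else 0)"

definition freealg :: "(agen list \<Rightarrow> 'k::field) ring" where
  "freealg = \<lparr>carrier = {f. finite {w. f w \<noteq> 0}},
              monoid.mult = (\<lambda>f g w. \<Sum>i\<le>length w. f (take i w) * g (drop i w)),
              one = fword [],
              zero = (\<lambda>w. 0),
              add = (\<lambda>f g w. f w + g w)\<rparr>"

definition fsmult :: "'k::field \<Rightarrow> (agen list \<Rightarrow> 'k) \<Rightarrow> (agen list \<Rightarrow> 'k)" where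
  "fsmult c f = (\<lambda>w. c * f w)"

definition rel_Hp :: "agen list \<Rightarrow> 'k::field" where
  "rel_Hp = (\<lambda>w. fword [GH,GXp] w - fword [GXp,GH] w - 2 * fword [GXp] w)"

definition rel_Hm :: "agen list \<Rightarrow> 'k::field" where
  "rel_Hm = (\<lambda>w. fword [GH,GXm] w - fword [GXm,GH] w + 2 * fword [GXm] w)"

definition rel_pm :: "agen list \<Rightarrow> 'k::field" where
  "rel_pm = (\<lambda>w. fword [GXp,GXm] w - fword [GXm,GXp] w - fword [GH] w)"

definition I_a :: "(agen list \<Rightarrow> 'k::field) set" where
  "I_a = genideal freealg {rel_Hp, rel_Hm}"

definition I_sl2 :: "(agen list \<Rightarrow> 'k::field) set" where
  "I_sl2 = genideal freealg {rel_Hp, rel_Hm, rel_pm}"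

definition Ua :: "(agen list \<Rightarrow> 'k::field) set ring" where
  "Ua = freealg Quot I_a"

definition Usl2 :: "(agen list \<Rightarrow> 'k::field) set ring" where
  "Usl2 = freealg Quot I_sl2"

definition qsmult :: "('a, 'm) ring_scheme \<Rightarrow> 'a set \<Rightarrow> ('c \<Rightarrow> 'a \<Rightarrow> 'a) \<Rightarrow> 'c \<Rightarrow> 'a set \<Rightarrow> 'a set" where
  "qsmult R I sm c C = a_r_coset R I (sm c (SOME x. x \<in> C))"

definition Ua_sm :: "'k::field \<Rightarrow> (agen list \<Rightarrow> 'k) set \<Rightarrow> (agen list \<Rightarrow> 'k) set" where
  "Ua_sm = qsmult freealg I_a fsmult"

definition Usl2_sm :: "'k::field \<Rightarrow> (agen list \<Rightarrow> 'k) set \<Rightarrow> (agen list \<Rightarrow> 'k) set" where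
  "Usl2_sm = qsmult freealg I_sl2 fsmult"

definition Ua_gen :: "agen \<Rightarrow> (agen list \<Rightarrow> 'k::field) set" where
  "Ua_gen x = a_r_coset freealg I_a (fword [x])"

definition Usl2_gen :: "agen \<Rightarrow> (agen list \<Rightarrow> 'k::field) set" where
  "Usl2_gen x = a_r_coset freealg I_sl2 (fword [x])"

definition proj_sl2 :: "(agen list \<Rightarrow> 'k::field) set \<Rightarrow> (agen list \<Rightarrow> 'k) set" where
  "proj_sl2 C = a_r_coset freealg I_sl2 (SOME f. f \<in> C)"

definition series_ring :: "('a, 'm) ring_scheme \<Rightarrow> (nat \<Rightarrow> 'a) ring" where
  "series_ring R = \<lparr>carrier = {u. \<forall>m. u m \<in> carrier R},
     monoid.mult = (\<lambda>u v m. finsum R (\<lambda>i. u i \<otimes>\<^bsub>R\<^esub> v (m - i)) {..m}),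
     one = (\<lambda>m. if m = 0 then \<one>\<^bsub>R\<^esub> else \<zero>\<^bsub>R\<^esub>),
     zero = (\<lambda>m. \<zero>\<^bsub>R\<^esub>),
     add = (\<lambda>u v m. u m \<oplus>\<^bsub>R\<^esub> v m)\<rparr>"

definition ser_smult :: "('a, 'm) ring_scheme \<Rightarrow> ('k::field \<Rightarrow> 'a \<Rightarrow> 'a) \<Rightarrow> 'k fps \<Rightarrow> (nat \<Rightarrow> 'a) \<Rightarrow> (nat \<Rightarrow> 'a)" where
  "ser_smult R sm c u = (\<lambda>m. finsum R (\<lambda>i. sm (fps_nth c i) (u (m - i))) {..m})"

definition const_ser :: "('a, 'm) ring_scheme \<Rightarrow> 'a \<Rightarrow> (nat \<Rightarrow> 'a)" where
  "const_ser R x = (\<lambda>m. if m = 0 then x else \<zero>\<^bsub>R\<^esub>)"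

definition Uha :: "(nat \<Rightarrow> (agen list \<Rightarrow> 'k::field) set) ring" where
  "Uha = series_ring Ua"

definition Usl2h :: "(nat \<Rightarrow> (agen list \<Rightarrow> 'k::field) set) ring" where
  "Usl2h = series_ring Usl2"

definition Usl2h_sm :: "'k::field fps \<Rightarrow> (nat \<Rightarrow> (agen list \<Rightarrow> 'k) set) \<Rightarrow> (nat \<Rightarrow> (agen list \<Rightarrow> 'k) set)" where
  "Usl2h_sm = ser_smult Usl2 Usl2_sm"

definition Usl2h_gen :: "agen \<Rightarrow> nat \<Rightarrow> (agen list \<Rightarrow> 'k::field) set" where
  "Usl2h_gen x = const_ser Usl2 (Usl2_gen x)"

text \<open>A colouring psi: psi k n for k \<ge> 1 (the value at k = 0 is irrelevant).\<close>

definition colouring :: "(nat \<Rightarrow> int \<Rightarrow> 'k::field_char_0 fps) \<Rightarrow> bool" where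
  "colouring \<psi> \<longleftrightarrow>
     (\<forall>k\<ge>1. \<forall>n. fps_nth (\<psi> k n) 0 = of_nat k * (of_int n - of_nat k + 1)) \<and>
     (\<forall>n::nat. \<psi> (n + 1) (int n) = 0) \<and>
     (\<forall>k\<ge>1. \<forall>n::nat. \<psi> (n + k + 1) (int n) = \<psi> k (- int n - 2))"

text \<open>Bivariate polynomials k[x,y] are represented as k[x][y], i.e. 'k poly poly;
  P(x,y) is evaluated as poly (poly P [:y:]) x.\<close>

definition regular_colouring :: "(nat \<Rightarrow> int \<Rightarrow> 'k::field_char_0 fps) \<Rightarrow> bool" where
  "regular_colouring \<psi> \<longleftrightarrow> colouring \<psi> \<and>
     (\<forall>m. \<exists>P :: 'k poly poly. \<forall>k\<ge>1. \<forall>n.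
         fps_nth (\<psi> k n) m = poly (poly P [:of_int n:]) (of_nat k))"

text \<open>A vector of V_h(n,psi) = (\<Oplus>_k k b_k)[[h]] is a function v with v m k the coefficient
  of h^m b_k; for each m only finitely many k are nonzero.\<close>

definition Vspace :: "(nat \<Rightarrow> nat \<Rightarrow> 'k::field) set" where
  "Vspace = {v. \<forall>m. finite {k. v m k \<noteq> 0}}"

definition gen_act :: "(nat \<Rightarrow> int \<Rightarrow> 'k::field_char_0 fps) \<Rightarrow> int \<Rightarrow> agen \<Rightarrow>
    (nat \<Rightarrow> nat \<Rightarrow> 'k) \<Rightarrow> (nat \<Rightarrow> nat \<Rightarrow> 'k)" where
  "gen_act \<psi> n g v = (case g of
      GH \<Rightarrow> (\<lambda>m k. (of_int n - 2 * of_nat k) * v m k)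
    | GXm \<Rightarrow> (\<lambda>m k. if k = 0 then 0 else v m (k - 1))
    | GXp \<Rightarrow> (\<lambda>m k. \<Sum>i\<le>m. fps_nth (\<psi> (Suc k) n) i * v (m - i) (Suc k)))"

definition word_act :: "(nat \<Rightarrow> int \<Rightarrow> 'k::field_char_0 fps) \<Rightarrow> int \<Rightarrow> agen list \<Rightarrow>
    (nat \<Rightarrow> nat \<Rightarrow> 'k) \<Rightarrow> (nat \<Rightarrow> nat \<Rightarrow> 'k)" where
  "word_act \<psi> n w v = foldr (gen_act \<psi> n) w v"

definition free_act :: "(nat \<Rightarrow> int \<Rightarrow> 'k::field_char_0 fps) \<Rightarrow> int \<Rightarrow> (agen list \<Rightarrow> 'k) \<Rightarrow>
    (nat \<Rightarrow> nat \<Rightarrow> 'k) \<Rightarrow> (nat \<Rightarrow> nat \<Rightarrow> 'k)" where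
  "free_act \<psi> n f v = (\<lambda>m k. \<Sum>w\<in>{w. f w \<noteq> 0}. f w * word_act \<psi> n w v m k)"

definition Ua_act :: "(nat \<Rightarrow> int \<Rightarrow> 'k::field_char_0 fps) \<Rightarrow> int \<Rightarrow> (agen list \<Rightarrow> 'k) set \<Rightarrow>
    (nat \<Rightarrow> nat \<Rightarrow> 'k) \<Rightarrow> (nat \<Rightarrow> nat \<Rightarrow> 'k)" where
  "Ua_act \<psi> n C v = free_act \<psi> n (SOME f. f \<in> C) v"

definition Uha_act :: "(nat \<Rightarrow> int \<Rightarrow> 'k::field_char_0 fps) \<Rightarrow> int \<Rightarrow> (nat \<Rightarrow> (agen list \<Rightarrow> 'k) set) \<Rightarrow>
    (nat \<Rightarrow> nat \<Rightarrow> 'k) \<Rightarrow> (nat \<Rightarrow> nat \<Rightarrow> 'k)" where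
  "Uha_act \<psi> n u v = (\<lambda>m k. \<Sum>i\<le>m. Ua_act \<psi> n (u i) v (m - i) k)"

definition ann :: "(nat \<Rightarrow> int \<Rightarrow> 'k::field_char_0 fps) \<Rightarrow> (nat \<Rightarrow> (agen list \<Rightarrow> 'k) set) set" where
  "ann \<psi> = {u \<in> carrier Uha. \<forall>n::int. \<forall>v\<in>Vspace. Uha_act \<psi> n u v = (\<lambda>m k. 0)}"

definition Uhpsi :: "(nat \<Rightarrow> int \<Rightarrow> 'k::field_char_0 fps) \<Rightarrow> (nat \<Rightarrow> (agen list \<Rightarrow> 'k) set) set ring" where
  "Uhpsi \<psi> = Uha Quot ann \<psi>"

definition Uhpsi_sm :: "(nat \<Rightarrow> int \<Rightarrow> 'k::field_char_0 fps) \<Rightarrow> 'k fps \<Rightarrow>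
    (nat \<Rightarrow> (agen list \<Rightarrow> 'k) set) set \<Rightarrow> (nat \<Rightarrow> (agen list \<Rightarrow> 'k) set) set" where
  "Uhpsi_sm \<psi> = qsmult Uha (ann \<psi>) (ser_smult Ua Ua_sm)"

definition Uhpsi_gen :: "(nat \<Rightarrow> int \<Rightarrow> 'k::field_char_0 fps) \<Rightarrow> agen \<Rightarrow> (nat \<Rightarrow> (agen list \<Rightarrow> 'k) set) set" where
  "Uhpsi_gen \<psi> x = a_r_coset Uha (ann \<psi>) (const_ser Ua (Ua_gen x))"

definition hU :: "(nat \<Rightarrow> int \<Rightarrow> 'k::field_char_0 fps) \<Rightarrow> (nat \<Rightarrow> (agen list \<Rightarrow> 'k) set) set set" where
  "hU \<psi> = {Uhpsi_sm \<psi> fps_X x | x. x \<in> carrier (Uhpsi \<psi>)}"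

definition Uhpsi_bar :: "(nat \<Rightarrow> int \<Rightarrow> 'k::field_char_0 fps) \<Rightarrow> (nat \<Rightarrow> (agen list \<Rightarrow> 'k) set) set set ring" where
  "Uhpsi_bar \<psi> = Uhpsi \<psi> Quot hU \<psi>"

definition Uhpsi_bar_sm :: "(nat \<Rightarrow> int \<Rightarrow> 'k::field_char_0 fps) \<Rightarrow> 'k \<Rightarrow>
    (nat \<Rightarrow> (agen list \<Rightarrow> 'k) set) set set \<Rightarrow> (nat \<Rightarrow> (agen list \<Rightarrow> 'k) set) set set" where
  "Uhpsi_bar_sm \<psi> = qsmult (Uhpsi \<psi>) (hU \<psi>) (\<lambda>c. Uhpsi_sm \<psi> (fps_const c))"

definition struct_bar :: "(nat \<Rightarrow> int \<Rightarrow> 'k::field_char_0 fps) \<Rightarrow> (agen list \<Rightarrow> 'k) set \<Rightarrow>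
    (nat \<Rightarrow> (agen list \<Rightarrow> 'k) set) set set" where
  "struct_bar \<psi> C = a_r_coset (Uhpsi \<psi>) (hU \<psi>) (a_r_coset Uha (ann \<psi>) (const_ser Ua C))"

text \<open>The induced map g-bar : U(sl2) \<cong> U(sl2)[[h]]/h \<rightarrow> U_h(psi)/h U_h(psi).\<close>

definition gbar :: "(nat \<Rightarrow> int \<Rightarrow> 'k::field_char_0 fps) \<Rightarrow>
    ((nat \<Rightarrow> (agen list \<Rightarrow> 'k) set) \<Rightarrow> (nat \<Rightarrow> (agen list \<Rightarrow> 'k) set) set) \<Rightarrow>
    (agen list \<Rightarrow> 'k) set \<Rightarrow> (nat \<Rightarrow> (agen list \<Rightarrow> 'k) set) set set" where
  "gbar \<psi> g u = a_r_coset (Uhpsi \<psi>) (hU \<psi>) (g (const_ser Usl2 u))"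

definition b_trivialization :: "(nat \<Rightarrow> int \<Rightarrow> 'k::field_char_0 fps) \<Rightarrow>
    ((nat \<Rightarrow> (agen list \<Rightarrow> 'k) set) \<Rightarrow> (nat \<Rightarrow> (agen list \<Rightarrow> 'k) set) set) \<Rightarrow> bool" where
  "b_trivialization \<psi> g \<longleftrightarrow>
     \<comment> \<open>k[[h]]-algebra isomorphism\<close>
     g \<in> ring_iso Usl2h (Uhpsi \<psi>) \<and>
     (\<forall>c. \<forall>x\<in>carrier Usl2h. g (Usl2h_sm c x) = Uhpsi_sm \<psi> c (g x)) \<and>
     \<comment> \<open>g(H) = H, g(X^-) = X^-\<close>
     g (Usl2h_gen GH) = Uhpsi_gen \<psi> GH \<and>
     g (Usl2h_gen GXm) = Uhpsi_gen \<psi> GXm \<and>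
     \<comment> \<open>g-bar is an isomorphism of a-algebras\<close>
     gbar \<psi> g \<in> ring_iso Usl2 (Uhpsi_bar \<psi>) \<and>
     (\<forall>c. \<forall>u\<in>carrier Usl2. gbar \<psi> g (Usl2_sm c u) = Uhpsi_bar_sm \<psi> c (gbar \<psi> g u)) \<and>
     (\<forall>x\<in>carrier Ua. gbar \<psi> g (proj_sl2 x) = struct_bar \<psi> x)"

definition b_trivial :: "(nat \<Rightarrow> int \<Rightarrow> 'k::field_char_0 fps) \<Rightarrow> bool" where
  "b_trivial \<psi> \<longleftrightarrow> (\<exists>g. b_trivialization \<psi> g)"

end

theory Submission
  imports Defs "HOL-Algebra.UnivPoly"
begin

text \<open>
  For the undeformed colouring \<open>k(n - k + 1)\<close>, the modules \<open>V(n)\<close> are the Verma modules of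
  \<open>sl\<^sub>2\<close>; by PBW they are jointly faithful for \<open>U(sl\<^sub>2)\<close>. Let \<open>\<psi>\<close> be regular and let
  \<open>P(k, n)\<close> be its coefficient of \<open>h\<^sup>m\<close>. Conditions (C2) and (C3) say that \<open>P\<close> vanishes on
  \<open>k = n + 1\<close> and is invariant under \<open>(k, n) \<mapsto> (k - n - 1, -n - 2)\<close>, so \<open>P = k(n - k + 1) B\<close> with
  \<open>B\<close> a polynomial in the weight \<open>n - 2k\<close> and in \<open>(n + 1)\<^sup>2\<close>, that is, in \<open>H\<close> and the Casimir
  element. Hence \<open>X\<^sup>+\<close> acts on \<open>V\<^sub>h(n, \<psi>)\<close> as an element of \<open>U(sl\<^sub>2)[[h]]\<close> congruent to \<open>X\<^sup>+\<close>
  modulo \<open>h\<close>. So \<open>U\<^sub>h(\<psi>)\<close> and \<open>U(sl\<^sub>2)[[h]]\<close> have the same image in the operators on the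
  common underlying space (one inclusion by successive approximation in \<open>h\<close>), and both act
  faithfully; matching operators is the trivialization. For uniqueness, any image of \<open>X\<^sup>+\<close> has
  weight 2 and a prescribed commutator with \<open>X\<^sup>-\<close>. This determines it on \<open>b\<^sub>0\<close>, and then on every
  \<open>b\<^sub>k\<close>.
\<close>

section \<open>The free algebra\<close>

text \<open>The actions, scalar multiplications and quotient maps choose coset representatives by
  \<open>SOME\<close>. Once an ideal acts by zero, the choice is invisible to operators, so elements
  are compared only through their operators, and each equality of elements becomes a question of
  faithfulness. Conditions (C2) and (C3) speak only of n >= 0, and a colouring says nothing about k
  = 0. Regularity turns both conditions into polynomial identities valid everywhere. The factor k of
  P, which no condition provides directly, then comes from the symmetry, which exchanges the lines k
  = 0 and k = n + 1. As k(n - k + 1) is the undeformed coefficient of X^+, what remains of X^+ on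
  V_h(n, psi) is diagonal in the b_k. The two inclusions of images are of different nature. From psi
  to sl2, every generator is rewritten exactly and the resulting series are summed by total degree.
  From sl2 to psi there is no such formula; one power of h is removed at a time, because (C1) makes
  the two actions agree modulo h.\<close>

definition word_sum :: "(agen list \<Rightarrow> 'k::field) \<Rightarrow> (agen list \<Rightarrow> 'k fps) \<Rightarrow> 'k fps" where
  "word_sum f A = (\<Sum>w\<in>{w. f w \<noteq> 0}. fps_const (f w) * A w)"

lemma freealg_simps:
  "f \<in> carrier freealg \<longleftrightarrow> finite {w. f w \<noteq> 0}"
  "f \<otimes>\<^bsub>freealg\<^esub> g = (\<lambda>w. \<Sum>i\<le>length w. f (take i w) * g (drop i w))"
  "\<one>\<^bsub>freealg\<^esub> = fword []"
  "\<zero>\<^bsub>freealg\<^esub> = (\<lambda>w. 0)"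
  "f \<oplus>\<^bsub>freealg\<^esub> g = (\<lambda>w. f w + g w)"
  by (simp_all add: freealg_def)

lemma word_sum_superset:
  assumes "finite W" "{w. f w \<noteq> 0} \<subseteq> W"
  shows "word_sum f A = (\<Sum>w\<in>W. fps_const (f w) * A w)"
  unfolding word_sum_def by (rule sum.mono_neutral_left) (use assms in auto)

lemma mult_support:
  assumes "(f \<otimes>\<^bsub>freealg\<^esub> g) w \<noteq> 0"
  shows "w \<in> (\<lambda>(u, v). u @ v) ` ({w. f w \<noteq> 0} \<times> {w. g w \<noteq> 0})"
proof -
  obtain i where "i \<le> length w" "f (take i w) * g (drop i w) \<noteq> 0"
    using assms by (metis (no_types, lifting) atMost_iff freealg_simps(2) sum.neutral)
  then show ?thesis by (intro image_eqI[of _ _ "(take i w, drop i w)"]) auto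
qed

lemma freealg_mult_closed:
  assumes "f \<in> carrier freealg" "g \<in> carrier freealg"
  shows "f \<otimes>\<^bsub>freealg\<^esub> g \<in> carrier freealg"
proof -
  have "finite ((\<lambda>(u, v). u @ v) ` ({w. f w \<noteq> 0} \<times> {w. g w \<noteq> 0}))"
    using assms by (simp add: freealg_simps(1))
  then show ?thesis
    unfolding freealg_simps(1) by (rule finite_subset[rotated]) (use mult_support in blast)
qed

text \<open>A word w with a cut position i is the same as a pair of words u, v with w = u @ v, so
  the convolution over cuts becomes a double sum over the two supports. Together with
  \<open>word_op_append\<close> this makes \<open>free_op\<close> multiplicative.\<close>

lemma word_sum_mult:
  fixes f g :: "agen list \<Rightarrow> 'k::field"
  assumes f: "f \<in> carrier freealg" and g: "g \<in> carrier freealg"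
  shows "word_sum (f \<otimes>\<^bsub>freealg\<^esub> g) A = word_sum f (\<lambda>u. word_sum g (\<lambda>v. A (u @ v)))"
proof -
  let ?F = "{w. f w \<noteq> 0}" and ?G = "{w. g w \<noteq> 0}"
  define W where "W = (\<lambda>(u, v). u @ v) ` (?F \<times> ?G)"
  have fin: "finite ?F" "finite ?G" using f g by (simp_all add: freealg_simps(1))
  then have W: "finite W" unfolding W_def by simp
  have inW: "u @ v \<in> W" if "f u \<noteq> 0" "g v \<noteq> 0" for u v using that unfolding W_def by auto
  have sub: "{w. (f \<otimes>\<^bsub>freealg\<^esub> g) w \<noteq> 0} \<subseteq> W"
    unfolding W_def using mult_support by blast
  let ?t = "\<lambda>(w, i). fps_const (f (take i w) * g (drop i w)) * A w"
  have "word_sum (f \<otimes>\<^bsub>freealg\<^esub> g) A =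
      (\<Sum>w\<in>W. \<Sum>i\<le>length w. fps_const (f (take i w) * g (drop i w)) * A w)"
  proof -
    have c: "fps_const (\<Sum>i\<in>J. h i) = (\<Sum>i\<in>J. fps_const (h i))" for h :: "nat \<Rightarrow> 'k" and J
      by (induction J rule: infinite_finite_induct) (auto simp flip: fps_const_add)
    show ?thesis
      unfolding word_sum_superset[OF W sub] unfolding freealg_simps(2) c sum_distrib_right ..
  qed
  also have "\<dots> = (\<Sum>p\<in>(SIGMA w:W. {..length w}). ?t p)"
    using W by (subst sum.Sigma) auto
  \<comment> \<open>Only cuts whose halves lie in the two supports are kept; on these, cutting and
    concatenating are inverse to each other.\<close>
  also have "\<dots> = (\<Sum>p\<in>{(w, i). w \<in> W \<and> i \<le> length w \<and> f (take i w) \<noteq> 0 \<and> g (drop i w) \<noteq> 0}. ?t p)"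
    using W by (intro sum.mono_neutral_right) auto
  also have "\<dots> = (\<Sum>(u, v)\<in>?F \<times> ?G. fps_const (f u) * (fps_const (g v) * A (u @ v)))"
    by (rule sum.reindex_bij_witness[of _ "\<lambda>(u, v). (u @ v, length u)"
          "\<lambda>(w, i). (take i w, drop i w)"])
      (auto simp: inW mult.assoc simp flip: fps_const_mult)
  also have "\<dots> = word_sum f (\<lambda>u. word_sum g (\<lambda>v. A (u @ v)))"
    unfolding word_sum_def using fin by (simp add: sum.cartesian_product sum_distrib_left)
  finally show ?thesis .
qed

lemma word_sum_add:
  assumes "f \<in> carrier freealg" "g \<in> carrier freealg"
  shows "word_sum (f \<oplus>\<^bsub>freealg\<^esub> g) A = word_sum f A + word_sum g A"
proof -
  let ?W = "{w. f w \<noteq> 0} \<union> {w. g w \<noteq> 0}"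
  have W: "finite ?W" using assms by (simp add: freealg_simps(1))
  have "word_sum (f \<oplus>\<^bsub>freealg\<^esub> g) A = (\<Sum>w\<in>?W. fps_const (f w + g w) * A w)"
    by (subst word_sum_superset[OF W]) (auto simp: freealg_simps)
  also have "\<dots> = (\<Sum>w\<in>?W. fps_const (f w) * A w) + (\<Sum>w\<in>?W. fps_const (g w) * A w)"
    by (simp add: sum.distrib ring_distribs flip: fps_const_add)
  finally show ?thesis using W by (simp add: word_sum_superset[of ?W])
qed

lemma word_sum_smult: "word_sum (fsmult c f) A = fps_const c * word_sum f A"
proof (cases "c = 0")
  case False
  then have "{w. fsmult c f w \<noteq> 0} = {w. f w \<noteq> 0}" by (auto simp: fsmult_def)
  then show ?thesis
    by (simp add: word_sum_def sum_distrib_left fsmult_def mult.assoc flip: fps_const_mult)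
qed (simp add: word_sum_def fsmult_def)

lemma word_sum_fword: "word_sum (fword w) A = A w"
  by (simp add: word_sum_def fword_def)

lemma fword_closed: "fword w \<in> carrier freealg"
  by (simp add: freealg_simps fword_def)

lemma fsmult_closed: "f \<in> carrier freealg \<Longrightarrow> fsmult c f \<in> carrier freealg"
  unfolding freealg_simps fsmult_def by (erule finite_subset[rotated]) auto

lemma freealg_add_closed:
  "f \<in> carrier freealg \<Longrightarrow> g \<in> carrier freealg \<Longrightarrow> f \<oplus>\<^bsub>freealg\<^esub> g \<in> carrier freealg"
  unfolding freealg_simps
  by (rule finite_subset[of _ "{w. f w \<noteq> 0} \<union> {w. g w \<noteq> 0}"]) auto

lemma ring_freealg: "ring (freealg :: (agen list \<Rightarrow> 'k::field) ring)"
proof (intro ringI abelian_groupI monoidI)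
  fix x y z :: "agen list \<Rightarrow> 'k"
  show "x \<otimes>\<^bsub>freealg\<^esub> y \<otimes>\<^bsub>freealg\<^esub> z = x \<otimes>\<^bsub>freealg\<^esub> (y \<otimes>\<^bsub>freealg\<^esub> z)"
  proof
    fix w :: "agen list"
    let ?L = "length w"
    \<comment> \<open>Both bracketings sum over two cuts j <= i of the same word: the left one runs
      through the later cut first, the right one through the earlier cut and the distance l = i -
      j.\<close>
    have "(x \<otimes>\<^bsub>freealg\<^esub> y \<otimes>\<^bsub>freealg\<^esub> z) w
      = (\<Sum>(i, j)\<in>(SIGMA i:{..?L}. {..i}). x (take j w) * y (drop j (take i w)) * z (drop i w))"
    proof -
      have "(x \<otimes>\<^bsub>freealg\<^esub> y \<otimes>\<^bsub>freealg\<^esub> z) w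
        = (\<Sum>i\<le>?L. \<Sum>j\<le>i. x (take j w) * y (drop j (take i w)) * z (drop i w))"
        unfolding freealg_simps
        by (rule sum.cong) (auto simp: sum_distrib_right min_def intro!: sum.cong)
      then show ?thesis by (simp add: sum.Sigma)
    qed
    also have "\<dots> = (\<Sum>(j, l)\<in>(SIGMA j:{..?L}. {..?L - j}).
        x (take j w) * (y (take l (drop j w)) * z (drop l (drop j w))))"
      by (rule sum.reindex_bij_witness[of _ "\<lambda>(j, l). (j + l, j)" "\<lambda>(i, j). (j, i - j)"])
        (auto simp: drop_take algebra_simps)
    also have "\<dots> = (x \<otimes>\<^bsub>freealg\<^esub> (y \<otimes>\<^bsub>freealg\<^esub> z)) w"
      unfolding freealg_simps by (subst sum.Sigma[symmetric]) (auto simp: sum_distrib_left)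
    finally show "(x \<otimes>\<^bsub>freealg\<^esub> y \<otimes>\<^bsub>freealg\<^esub> z) w = (x \<otimes>\<^bsub>freealg\<^esub> (y \<otimes>\<^bsub>freealg\<^esub> z)) w" .
  qed
next
  fix x :: "agen list \<Rightarrow> 'k"
  have "(\<Sum>i\<le>length w. fword [] (take i w) * x (drop i w)) = (\<Sum>i\<le>length w. if i = 0 then x w else 0)" for w
    by (rule sum.cong) (auto simp: fword_def)
  then show "\<one>\<^bsub>freealg\<^esub> \<otimes>\<^bsub>freealg\<^esub> x = x"
    by (simp add: freealg_simps)
  have "(\<Sum>i\<le>length w. x (take i w) * fword [] (drop i w)) = (\<Sum>i\<le>length w. if i = length w then x w else 0)" for w
    by (rule sum.cong) (auto simp: fword_def)
  then show "x \<otimes>\<^bsub>freealg\<^esub> \<one>\<^bsub>freealg\<^esub> = x"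
    by (simp add: freealg_simps)
  assume "x \<in> carrier freealg"
  then show "\<exists>y\<in>carrier freealg. y \<oplus>\<^bsub>freealg\<^esub> x = \<zero>\<^bsub>freealg\<^esub>"
    by (intro bexI[of _ "fsmult (-1) x"]) (auto simp: fsmult_closed, simp add: freealg_simps fsmult_def)
qed (simp_all add: freealg_mult_closed freealg_add_closed freealg_simps(3) fword_closed,
     simp_all add: freealg_simps ring_distribs sum.distrib add_ac)

interpretation freealg: ring freealg
  by (rule ring_freealg)

text \<open>Scalars act as multiples of the unit, so every ring ideal of the free algebra is closed
  under them; see \<open>fsmult_I\<close>.\<close>

lemma fsmult_eq_mult:
  "fsmult c f = fsmult c (fword []) \<otimes>\<^bsub>freealg\<^esub> f"
proof
  fix w
  have "(fsmult c (fword []) \<otimes>\<^bsub>freealg\<^esub> f) w = (\<Sum>i\<le>length w. if i = 0 then c * f w else 0)"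
    unfolding freealg_simps by (rule sum.cong) (auto simp: fword_def fsmult_def)
  then show "fsmult c f w = (fsmult c (fword []) \<otimes>\<^bsub>freealg\<^esub> f) w"
    by (simp add: fsmult_def)
qed

lemma fsmult_mult_right:
  "f \<otimes>\<^bsub>freealg\<^esub> fsmult c g = fsmult c (f \<otimes>\<^bsub>freealg\<^esub> g)"
  by (simp add: freealg_simps fsmult_def sum_distrib_left mult.left_commute)

lemma fword_mult: "fword u \<otimes>\<^bsub>freealg\<^esub> fword v = (fword (u @ v) :: agen list \<Rightarrow> 'k::field)"
proof
  fix w :: "agen list"
  have "(fword u (take i w) * fword v (drop i w) :: 'k) = (if i = length u then fword (u @ v) w else 0)"
    if "i \<le> length w" for i
  proof (cases "i = length u")
    case True
    have "w = u @ v \<longleftrightarrow> take i w = u \<and> drop i w = v"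
      unfolding True by (metis append_eq_conv_conj)
    then show ?thesis using True by (auto simp: fword_def)
  next
    case False
    then have "take i w \<noteq> u" using that by auto
    then show ?thesis using False by (simp add: fword_def)
  qed
  then have "(fword u \<otimes>\<^bsub>freealg\<^esub> fword v) w
      = (\<Sum>i\<le>length w. if i = length u then fword (u @ v) w else (0::'k))"
    by (simp add: freealg_simps)
  also have "\<dots> = fword (u @ v) w" by (auto simp: fword_def)
  finally show "(fword u \<otimes>\<^bsub>freealg\<^esub> fword v) w = (fword (u @ v) w :: 'k)" .
qed

lemma freealg_minus:
  assumes "f \<in> carrier freealg" "g \<in> carrier freealg"
  shows "f \<ominus>\<^bsub>freealg\<^esub> g = (\<lambda>w. f w - g w)"
proof -
  have "\<ominus>\<^bsub>freealg\<^esub> g = fsmult (-1) g"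
    by (rule freealg.minus_equality)
      (auto simp: fsmult_closed assms, simp add: freealg_simps fsmult_def)
  then show ?thesis by (simp add: a_minus_def freealg_simps fsmult_def)
qed

text \<open>Removing one word from the support at a time never leaves \<open>W\<close>. Keeping
  \<open>W\<close> in the rule allows inductions that meet only PBW words; elsewhere it is
  instantiated by \<open>UNIV\<close>.\<close>

lemma freealg_induct [consumes 2, case_names zero add]:
  assumes f: "f \<in> carrier freealg"
    and W: "{w. f w \<noteq> 0} \<subseteq> W"
    and zero: "P (\<lambda>w. 0)"
    and step: "\<And>f c w. f \<in> carrier freealg \<Longrightarrow> P f \<Longrightarrow> w \<in> W \<Longrightarrow> P (f \<oplus>\<^bsub>freealg\<^esub> fsmult c (fword w))"
  shows "P f"
proof -
  have "finite {w. f w \<noteq> 0}" using f by (simp add: freealg_simps)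
  then show ?thesis using W
  proof (induction "{w. f w \<noteq> 0}" arbitrary: f rule: finite_induct)
    case empty
    then have "f = (\<lambda>w. 0)" by auto
    then show ?case using zero by simp
  next
    case (insert x F)
    define f' where "f' = f(x := 0)"
    have F: "F = {w. f' w \<noteq> 0}" using insert(2,4) by (auto simp: f'_def)
    have "f = f' \<oplus>\<^bsub>freealg\<^esub> fsmult (f x) (fword x)"
      by (auto simp: f'_def freealg_simps fsmult_def fword_def)
    moreover have "P f'" using insert(3)[OF F] F insert(4,5) by auto
    moreover have "f' \<in> carrier freealg" using F insert(1) by (simp add: freealg_simps)
    moreover have "x \<in> W" using insert(4,5) by auto
    ultimately show ?case using step by metis
  qed
qed

section \<open>Operators on modules over formal power series\<close>

text \<open>This is the sum of all h^i * T i. It always converges h-adically, since only the terms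
  with i <= m reach the coefficient of h^m.\<close>

definition hsum :: "(nat \<Rightarrow> 'k::field fps) \<Rightarrow> 'k fps" where
  "hsum T = Abs_fps (\<lambda>m. \<Sum>i\<le>m. fps_nth (T i) (m - i))"

lemma hsum_nth: "fps_nth (hsum T) m = (\<Sum>i\<le>m. fps_nth (T i) (m - i))"
  by (simp add: hsum_def)

lemma hsum_nth_0 [simp]: "fps_nth (hsum T) 0 = fps_nth (T 0) 0"
  by (simp add: hsum_nth)

lemma hsum_zero [simp]: "hsum (\<lambda>i. 0) = 0"
  by (simp add: fps_eq_iff hsum_nth)

lemma hsum_add: "hsum (\<lambda>i. S i + T i) = hsum S + hsum T"
  by (simp add: fps_eq_iff hsum_nth sum.distrib)

lemma hsum_cmult: "hsum (\<lambda>i. c * T i) = c * hsum T"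
proof (rule fps_ext)
  fix m
  have "fps_nth (hsum (\<lambda>i. c * T i)) m
      = (\<Sum>(i, a)\<in>(SIGMA i:{..m}. {..m - i}). fps_nth c a * fps_nth (T i) (m - i - a))"
    by (simp add: hsum_nth fps_mult_nth sum.Sigma atLeast0AtMost)
  also have "\<dots> = (\<Sum>(a, i)\<in>(SIGMA a:{..m}. {..m - a}). fps_nth c a * fps_nth (T i) (m - a - i))"
    by (rule sum.reindex_bij_witness[of _ "\<lambda>(a, i). (i, a)" "\<lambda>(i, a). (a, i)"])
      (auto simp: add.commute)
  also have "\<dots> = fps_nth (c * hsum T) m"
    by (simp add: hsum_nth fps_mult_nth sum.Sigma[symmetric] atLeast0AtMost sum_distrib_left)
  finally show "fps_nth (hsum (\<lambda>i. c * T i)) m = fps_nth (c * hsum T) m" .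
qed

lemma hsum_sum: "hsum (\<lambda>i. \<Sum>j\<in>J. T j i) = (\<Sum>j\<in>J. hsum (T j))"
  by (induction J rule: infinite_finite_induct) (simp_all add: hsum_add)

text \<open>The double sum is collected by total degree. This turns the Cauchy product of two series
  into the composition of their operators.\<close>

lemma hsum_hsum: "hsum (\<lambda>i. hsum (T i)) = hsum (\<lambda>m. \<Sum>i\<le>m. T i (m - i))"
proof (rule fps_ext)
  fix m
  have "fps_nth (hsum (\<lambda>i. hsum (T i))) m
      = (\<Sum>(i, j)\<in>(SIGMA i:{..m}. {..m - i}). fps_nth (T i j) (m - i - j))"
    by (simp add: hsum_nth sum.Sigma)
  also have "\<dots> = (\<Sum>(l, i)\<in>(SIGMA l:{..m}. {..l}). fps_nth (T i (l - i)) (m - l))"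
    by (rule sum.reindex_bij_witness[of _ "\<lambda>(l, i). (i, l - i)" "\<lambda>(i, j). (i + j, i)"])
      (auto simp: add.commute)
  also have "\<dots> = fps_nth (hsum (\<lambda>m. \<Sum>i\<le>m. T i (m - i))) m"
    by (simp add: hsum_nth sum.Sigma[symmetric] fps_sum_nth)
  finally show "fps_nth (hsum (\<lambda>i. hsum (T i))) m = fps_nth (hsum (\<lambda>m. \<Sum>i\<le>m. T i (m - i))) m" .
qed

text \<open>Splitting off the constant term drives every argument by successive approximation or
  reduction modulo h below.\<close>

lemma hsum_rec: "hsum T = T 0 + fps_X * hsum (\<lambda>i. T (Suc i))"
proof (rule fps_ext)
  fix m show "fps_nth (hsum T) m = fps_nth (T 0 + fps_X * hsum (\<lambda>i. T (Suc i))) m"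
  proof (cases m)
    case (Suc l)
    then show ?thesis by (simp add: hsum_nth sum.atMost_Suc_shift del: sum.atMost_Suc)
  qed (simp add: hsum_nth)
qed

lemma hsum_fps_const: "hsum (\<lambda>i. fps_const (fps_nth c i)) = c"
proof (rule fps_ext)
  fix m
  have "fps_nth (hsum (\<lambda>i. fps_const (fps_nth c i))) m = (\<Sum>i\<le>m. if i = m then fps_nth c i else 0)"
    unfolding hsum_nth by (rule sum.cong) auto
  then show "fps_nth (hsum (\<lambda>i. fps_const (fps_nth c i))) m = fps_nth c m" by simp
qed

lemma hsum_single: "hsum (\<lambda>i. if i = 0 then x else 0) = x"
  by (subst hsum_rec) simp

text \<open>An element of \<open>V\<^sub>h\<close> is handled as a function from indices \<open>k\<close> to power series. All
  operators below are row-finite modulo powers of \<open>h\<close>, so they make sense on every such function,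
  not only on those with finitely many nonzero coordinates modulo each power of \<open>h\<close>.\<close>

definition gen_op :: "(nat \<Rightarrow> int \<Rightarrow> 'k::field_char_0 fps) \<Rightarrow> agen \<Rightarrow> int \<Rightarrow>
    (nat \<Rightarrow> 'k fps) \<Rightarrow> nat \<Rightarrow> 'k fps" where
  "gen_op \<psi> g n v k = (case g of
      GH \<Rightarrow> fps_const (of_int n - 2 * of_nat k) * v k
    | GXm \<Rightarrow> if k = 0 then 0 else v (k - 1)
    | GXp \<Rightarrow> \<psi> (Suc k) n * v (Suc k))"

definition word_op :: "(nat \<Rightarrow> int \<Rightarrow> 'k::field_char_0 fps) \<Rightarrow> agen list \<Rightarrow> int \<Rightarrow>
    (nat \<Rightarrow> 'k fps) \<Rightarrow> nat \<Rightarrow> 'k fps" where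
  "word_op \<psi> w n v = foldr (\<lambda>g. gen_op \<psi> g n) w v"

definition free_op :: "(nat \<Rightarrow> int \<Rightarrow> 'k::field_char_0 fps) \<Rightarrow> (agen list \<Rightarrow> 'k) \<Rightarrow> int \<Rightarrow>
    (nat \<Rightarrow> 'k fps) \<Rightarrow> nat \<Rightarrow> 'k fps" where
  "free_op \<psi> f n v k = word_sum f (\<lambda>w. word_op \<psi> w n v k)"

text \<open>The choice by \<open>SOME\<close> mirrors \<open>Ua_act\<close>. It is harmless exactly
  when the ideal acts by zero, which \<open>coset_rep\<close> assumes and \<open>coset_op_cl\<close>
  exploits.\<close>

definition coset_op :: "(nat \<Rightarrow> int \<Rightarrow> 'k::field_char_0 fps) \<Rightarrow> (agen list \<Rightarrow> 'k) set \<Rightarrow> int \<Rightarrow>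
    (nat \<Rightarrow> 'k fps) \<Rightarrow> nat \<Rightarrow> 'k fps" where
  "coset_op \<psi> C = free_op \<psi> (SOME f. f \<in> C)"

definition series_op :: "(nat \<Rightarrow> int \<Rightarrow> 'k::field_char_0 fps) \<Rightarrow> (nat \<Rightarrow> (agen list \<Rightarrow> 'k) set) \<Rightarrow>
    int \<Rightarrow> (nat \<Rightarrow> 'k fps) \<Rightarrow> nat \<Rightarrow> 'k fps" where
  "series_op \<psi> u n v k = hsum (\<lambda>i. coset_op \<psi> (u i) n v k)"

lemma word_op_Nil [simp]: "word_op \<psi> [] n v = v"
  and word_op_Cons [simp]: "word_op \<psi> (g # w) n v = gen_op \<psi> g n (word_op \<psi> w n v)"
  and word_op_append: "word_op \<psi> (u @ w) n v = word_op \<psi> u n (word_op \<psi> w n v)"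
  by (simp_all add: word_op_def)

lemma gen_op_hsum: "gen_op \<psi> g n (\<lambda>k. hsum (\<lambda>i. V i k)) = (\<lambda>k. hsum (\<lambda>i. gen_op \<psi> g n (V i) k))"
  by (auto simp: fun_eq_iff gen_op_def hsum_cmult split: agen.split)

lemma word_op_hsum: "word_op \<psi> w n (\<lambda>k. hsum (\<lambda>i. V i k)) = (\<lambda>k. hsum (\<lambda>i. word_op \<psi> w n (V i) k))"
  by (induction w) (simp_all add: gen_op_hsum)

lemma gen_op_sum: "gen_op \<psi> g n (\<lambda>k. \<Sum>i\<in>J. c i * V i k) = (\<lambda>k. \<Sum>i\<in>J. c i * gen_op \<psi> g n (V i) k)"
  by (auto simp: fun_eq_iff gen_op_def sum_distrib_left mult.left_commute split: agen.split)

lemma word_op_sum: "word_op \<psi> w n (\<lambda>k. \<Sum>i\<in>J. c i * V i k) = (\<lambda>k. \<Sum>i\<in>J. c i * word_op \<psi> w n (V i) k)"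
  by (induction w) (simp_all add: gen_op_sum)

lemma word_op_cmult: "word_op \<psi> w n (\<lambda>k. c * v k) = (\<lambda>k. c * word_op \<psi> w n v k)"
  using word_op_sum[of \<psi> w n "\<lambda>_. c" "\<lambda>_. v" "{()}"] by simp

text \<open>This is h-adic continuity, needed when a series of operators is applied to the result of
  another one.\<close>

lemma free_op_hsum:
  "free_op \<psi> f n (\<lambda>k. hsum (\<lambda>i. V i k)) = (\<lambda>k. hsum (\<lambda>i. free_op \<psi> f n (V i) k))"
  by (simp add: free_op_def word_op_hsum fun_eq_iff word_sum_def hsum_sum hsum_cmult)

lemma free_op_cmult: "free_op \<psi> f n (\<lambda>k. c * v k) = (\<lambda>k. c * free_op \<psi> f n v k)"
  by (simp add: free_op_def word_op_cmult fun_eq_iff word_sum_def sum_distrib_left mult_ac)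

lemma free_op_mult:
  assumes "f \<in> carrier freealg" "g \<in> carrier freealg"
  shows "free_op \<psi> (f \<otimes>\<^bsub>freealg\<^esub> g) n v = free_op \<psi> f n (free_op \<psi> g n v)"
proof
  fix k
  have "word_sum g (\<lambda>w. word_op \<psi> u n (word_op \<psi> w n v) k)
      = word_op \<psi> u n (\<lambda>k. word_sum g (\<lambda>w. word_op \<psi> w n v k)) k" for u
    unfolding word_sum_def by (subst word_op_sum) simp
  then show "free_op \<psi> (f \<otimes>\<^bsub>freealg\<^esub> g) n v k = free_op \<psi> f n (free_op \<psi> g n v) k"
    by (simp add: free_op_def[abs_def] word_sum_mult[OF assms] word_op_append)
qed

lemma free_op_add:
  assumes "f \<in> carrier freealg" "g \<in> carrier freealg"
  shows "free_op \<psi> (f \<oplus>\<^bsub>freealg\<^esub> g) n v k = free_op \<psi> f n v k + free_op \<psi> g n v k"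
  by (simp add: free_op_def word_sum_add[OF assms])

lemma free_op_smult: "free_op \<psi> (fsmult c f) n v k = fps_const c * free_op \<psi> f n v k"
  by (simp add: free_op_def word_sum_smult)

lemma free_op_fword: "free_op \<psi> (fword w) n v k = word_op \<psi> w n v k"
  by (simp add: free_op_def word_sum_fword)

lemma free_op_zero: "free_op \<psi> (\<lambda>w. 0) n v k = 0"
  by (simp add: free_op_def word_sum_def)

lemma free_op_minus:
  assumes "f \<in> carrier freealg" "g \<in> carrier freealg"
  shows "free_op \<psi> (f \<ominus>\<^bsub>freealg\<^esub> g) n v k = free_op \<psi> f n v k - free_op \<psi> g n v k"
proof -
  have "f \<ominus>\<^bsub>freealg\<^esub> g = f \<oplus>\<^bsub>freealg\<^esub> fsmult (-1) g"
    using assms by (simp add: freealg_minus) (simp add: freealg_simps fsmult_def)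
  then show ?thesis using assms
    by (simp add: free_op_add fsmult_closed free_op_smult fps_const_neg[symmetric] del: fps_const_neg)
qed

subsection \<open>Comparison with the action on \<open>V\<^sub>h\<close>\<close>

lemma word_act_eq:
  "word_act \<psi> n w v m k = fps_nth (word_op \<psi> w n (\<lambda>k. Abs_fps (\<lambda>m. v m k)) k) m"
proof (induction w arbitrary: m k)
  case (Cons g w)
  have "word_act \<psi> n (g # w) v m k = gen_act \<psi> n g (word_act \<psi> n w v) m k"
    by (simp add: word_act_def)
  also have "\<dots> = fps_nth (gen_op \<psi> g n (word_op \<psi> w n (\<lambda>k. Abs_fps (\<lambda>m. v m k))) k) m"
  proof (cases g)
    case GXp
    then show ?thesis by (simp add: gen_act_def gen_op_def Cons fps_mult_nth atLeast0AtMost)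
  qed (simp_all add: gen_act_def gen_op_def Cons)
  finally show ?case by simp
qed (simp add: word_act_def)

lemma Uha_act_eq:
  "Uha_act \<psi> n u v m k = fps_nth (series_op \<psi> u n (\<lambda>k. Abs_fps (\<lambda>m. v m k)) k) m"
  by (simp add: Uha_act_def Ua_act_def free_act_def series_op_def coset_op_def free_op_def
      word_sum_def hsum_nth fps_sum_nth word_act_eq)

text \<open>Each letter shifts the index by at most one, so a coordinate of the result sees only
  finitely many coordinates of the vector.\<close>

lemma word_op_local:
  "(\<And>j. j \<le> k + length w \<Longrightarrow> v j = v' j) \<Longrightarrow> word_op \<psi> w n v k = word_op \<psi> w n v' k"
  by (induction w arbitrary: k) (auto simp: gen_op_def split: agen.split)

text \<open>The annihilator is defined by vectors in \<open>Vspace\<close>, but the coefficient of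
  h^m in coordinate k depends on finitely many coordinates of the vector. Testing on truncations
  therefore settles arbitrary vectors.\<close>

lemma ann_iff: "u \<in> ann \<psi> \<longleftrightarrow> u \<in> carrier Uha \<and> (\<forall>n v k. series_op \<psi> u n v k = 0)"
proof (intro iffI conjI allI)
  assume u: "u \<in> ann \<psi>"
  then show "u \<in> carrier Uha" by (simp add: ann_def)
  fix n v k
  show "series_op \<psi> u n v k = 0"
  proof (rule fps_ext)
    fix m
    \<comment> \<open>These words are all that matter up to degree m. Representatives of infinite
      support are left out because their \<open>word_sum\<close> is 0 by the convention for infinite
      sums.\<close>
    define W where "W = (\<Union>i\<in>{..m}. {w. (SOME f. f \<in> u i) w \<noteq> 0 \<and>
        finite {w. (SOME f. f \<in> u i) w \<noteq> 0}})"
    have "finite W" unfolding W_def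
      by (rule finite_UN_I) (auto simp: conj_commute intro: finite_subset)
    then obtain N where N: "\<And>w. w \<in> W \<Longrightarrow> length w \<le> N"
      by (metis finite_imageI finite_nat_set_iff_bounded_le imageI)
    \<comment> \<open>No word of length at most N can carry a coordinate beyond k + N to k.\<close>
    define v' where "v' j = (if j \<le> k + N then v j else 0)" for j
    define x where "x m j = fps_nth (v' j) m" for m j
    have "x \<in> Vspace"
    proof -
      have "finite {j. x m j \<noteq> 0}" for m
        by (rule finite_subset[of _ "{..k + N}"]) (auto simp: x_def v'_def split: if_splits)
      then show ?thesis by (simp add: Vspace_def)
    qed
    then have "Uha_act \<psi> n u x m k = 0" using u by (simp add: ann_def)
    then have 0: "fps_nth (series_op \<psi> u n v' k) m = 0"
      unfolding Uha_act_eq by (simp add: x_def fps_nth_inverse)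
    have "coset_op \<psi> (u i) n v k = coset_op \<psi> (u i) n v' k" if "i \<le> m" for i
    proof (cases "finite {w. (SOME f. f \<in> u i) w \<noteq> 0}")
      case True
      have "word_op \<psi> w n v k = word_op \<psi> w n v' k" if "(SOME f. f \<in> u i) w \<noteq> 0" for w
      proof (rule word_op_local)
        have "w \<in> W" using that True \<open>i \<le> m\<close> by (auto simp: W_def)
        then show "v j = v' j" if "j \<le> k + length w" for j
          using that N[of w] by (simp add: v'_def)
      qed
      then show ?thesis by (simp add: coset_op_def free_op_def word_sum_def)
    qed (simp add: coset_op_def free_op_def word_sum_def)
    then show "fps_nth (series_op \<psi> u n v k) m = fps_nth 0 m"
      using 0 by (simp add: series_op_def hsum_nth)
  qed
next
  assume "u \<in> carrier Uha \<and> (\<forall>n v k. series_op \<psi> u n v k = 0)"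
  then show "u \<in> ann \<psi>" by (auto simp: ann_def Uha_act_eq fun_eq_iff)
qed

section \<open>Power series over a ring\<close>

lemma series_simps:
  "u \<in> carrier (series_ring R) \<longleftrightarrow> (\<forall>m. u m \<in> carrier R)"
  "u \<otimes>\<^bsub>series_ring R\<^esub> v = (\<lambda>m. finsum R (\<lambda>i. u i \<otimes>\<^bsub>R\<^esub> v (m - i)) {..m})"
  "\<one>\<^bsub>series_ring R\<^esub> = (\<lambda>m. if m = 0 then \<one>\<^bsub>R\<^esub> else \<zero>\<^bsub>R\<^esub>)"
  "\<zero>\<^bsub>series_ring R\<^esub> = (\<lambda>m. \<zero>\<^bsub>R\<^esub>)"
  "u \<oplus>\<^bsub>series_ring R\<^esub> v = (\<lambda>m. u m \<oplus>\<^bsub>R\<^esub> v m)"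
  by (simp_all add: series_ring_def)

lemma (in ring) series_mult_closed:
  assumes "u \<in> carrier (series_ring R)" "v \<in> carrier (series_ring R)"
  shows "u \<otimes>\<^bsub>series_ring R\<^esub> v \<in> carrier (series_ring R)"
  using assms by (auto simp: series_simps intro!: finsum_closed)

text \<open>The coefficient of degree \<open>m\<close> of a product only depends on the truncations of the factors, so
  associativity is inherited from polynomials.\<close>

lemma (in ring) series_mult_assoc:
  assumes u: "u \<in> carrier (series_ring R)" and v: "v \<in> carrier (series_ring R)"
    and w: "w \<in> carrier (series_ring R)"
  shows "u \<otimes>\<^bsub>series_ring R\<^esub> v \<otimes>\<^bsub>series_ring R\<^esub> w = u \<otimes>\<^bsub>series_ring R\<^esub> (v \<otimes>\<^bsub>series_ring R\<^esub> w)"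
proof
  fix m
  interpret UP: UP_ring R "UP R" by unfold_locales
  define t where "t x i = (if i \<le> m then x i else \<zero>)" for x :: "nat \<Rightarrow> 'a" and i
  have tc: "t x i \<in> carrier R" if "x \<in> carrier (series_ring R)" for x i
    using that by (simp add: t_def series_simps)
  have tUP: "t x \<in> carrier (UP R)" if x: "x \<in> carrier (series_ring R)" for x
  proof -
    have "bound \<zero> m (t x)" by (rule bound.intro) (simp add: t_def)
    then show ?thesis using tc[OF x] by (auto simp: UP_def)
  qed
  have UPm: "(p \<otimes>\<^bsub>UP R\<^esub> q) = p \<otimes>\<^bsub>series_ring R\<^esub> q"
    if "p \<in> carrier (UP R)" "q \<in> carrier (UP R)" for p q
    using that by (simp add: UP_def series_simps)
  have tm: "(x \<otimes>\<^bsub>series_ring R\<^esub> y) i = (x' \<otimes>\<^bsub>series_ring R\<^esub> y') i"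
    if "\<And>j. j \<le> m \<Longrightarrow> x j = x' j" "\<And>j. j \<le> m \<Longrightarrow> y j = y' j" "i \<le> m"
      "x' \<in> carrier (series_ring R)" "y' \<in> carrier (series_ring R)" for x y x' y' i
    unfolding series_simps by (rule finsum_cong') (use that in \<open>auto simp: series_simps\<close>)
  have UPc: "p \<in> carrier (series_ring R)" if "p \<in> carrier (UP R)" for p
    using that by (auto simp: UP_def series_simps)
  have t_eq: "t x i = x i" if "i \<le> m" for x i using that by (simp add: t_def)
  have "(u \<otimes>\<^bsub>series_ring R\<^esub> v \<otimes>\<^bsub>series_ring R\<^esub> w) m
      = (t u \<otimes>\<^bsub>series_ring R\<^esub> t v \<otimes>\<^bsub>series_ring R\<^esub> t w) m"
    by (intro tm series_mult_closed UPc tUP u v w) (simp_all add: t_eq)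
  also have "\<dots> = (t u \<otimes>\<^bsub>UP R\<^esub> t v \<otimes>\<^bsub>UP R\<^esub> t w) m"
    by (simp add: UPm tUP u v w flip: UPm)
  also have "\<dots> = (t u \<otimes>\<^bsub>UP R\<^esub> (t v \<otimes>\<^bsub>UP R\<^esub> t w)) m"
    by (simp add: UP.UP_m_assoc tUP u v w)
  also have "\<dots> = (t u \<otimes>\<^bsub>series_ring R\<^esub> (t v \<otimes>\<^bsub>series_ring R\<^esub> t w)) m"
    by (simp add: UPm tUP u v w flip: UPm)
  also have "\<dots> = (u \<otimes>\<^bsub>series_ring R\<^esub> (v \<otimes>\<^bsub>series_ring R\<^esub> w)) m"
    by (intro tm[symmetric] series_mult_closed UPc tUP u v w) (simp_all add: t_eq)
  finally show "(u \<otimes>\<^bsub>series_ring R\<^esub> v \<otimes>\<^bsub>series_ring R\<^esub> w) m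
      = (u \<otimes>\<^bsub>series_ring R\<^esub> (v \<otimes>\<^bsub>series_ring R\<^esub> w)) m" .
qed

lemma (in ring) ring_series: "ring (series_ring R)"
proof (intro ringI abelian_groupI monoidI)
  fix x assume x: "x \<in> carrier (series_ring R)"
  then show "\<exists>y\<in>carrier (series_ring R). y \<oplus>\<^bsub>series_ring R\<^esub> x = \<zero>\<^bsub>series_ring R\<^esub>"
    by (intro bexI[of _ "\<lambda>m. \<ominus> x m"]) (auto simp: series_simps l_neg)
  show "\<one>\<^bsub>series_ring R\<^esub> \<otimes>\<^bsub>series_ring R\<^esub> x = x"
  proof
    fix m
    have "(\<one>\<^bsub>series_ring R\<^esub> \<otimes>\<^bsub>series_ring R\<^esub> x) m = finsum R (\<lambda>i. if 0 = i then x (m - i) else \<zero>) {..m}"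
      unfolding series_simps by (rule finsum_cong') (use x in \<open>auto simp: series_simps\<close>)
    also have "\<dots> = x m"
      using x by (subst add.finprod_singleton) (auto simp: series_simps)
    finally show "(\<one>\<^bsub>series_ring R\<^esub> \<otimes>\<^bsub>series_ring R\<^esub> x) m = x m" .
  qed
  show "x \<otimes>\<^bsub>series_ring R\<^esub> \<one>\<^bsub>series_ring R\<^esub> = x"
  proof
    fix m
    have "(x \<otimes>\<^bsub>series_ring R\<^esub> \<one>\<^bsub>series_ring R\<^esub>) m = finsum R (\<lambda>i. if m = i then x i else \<zero>) {..m}"
      unfolding series_simps by (rule finsum_cong') (use x in \<open>auto simp: series_simps\<close>)
    also have "\<dots> = x m"
      using x by (subst add.finprod_singleton) (auto simp: series_simps)
    finally show "(x \<otimes>\<^bsub>series_ring R\<^esub> \<one>\<^bsub>series_ring R\<^esub>) m = x m" .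
  qed
  fix y z assume y: "y \<in> carrier (series_ring R)" and z: "z \<in> carrier (series_ring R)"
  show "x \<oplus>\<^bsub>series_ring R\<^esub> y \<oplus>\<^bsub>series_ring R\<^esub> z = x \<oplus>\<^bsub>series_ring R\<^esub> (y \<oplus>\<^bsub>series_ring R\<^esub> z)"
    using x y z by (simp add: series_simps a_assoc)
  show "x \<oplus>\<^bsub>series_ring R\<^esub> y = y \<oplus>\<^bsub>series_ring R\<^esub> x"
    using x y by (simp add: series_simps a_comm)
  show "(x \<oplus>\<^bsub>series_ring R\<^esub> y) \<otimes>\<^bsub>series_ring R\<^esub> z
      = x \<otimes>\<^bsub>series_ring R\<^esub> z \<oplus>\<^bsub>series_ring R\<^esub> y \<otimes>\<^bsub>series_ring R\<^esub> z"
    using x y z by (simp add: series_simps l_distr finsum_addf Pi_def)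
  show "z \<otimes>\<^bsub>series_ring R\<^esub> (x \<oplus>\<^bsub>series_ring R\<^esub> y)
      = z \<otimes>\<^bsub>series_ring R\<^esub> x \<oplus>\<^bsub>series_ring R\<^esub> z \<otimes>\<^bsub>series_ring R\<^esub> y"
    using x y z by (simp add: series_simps r_distr finsum_addf Pi_def)
qed (simp_all add: series_mult_closed series_mult_assoc, simp_all add: series_simps)

section \<open>Representations of quotients of the free algebra\<close>

text \<open>One setting serves both U(a), which acts for every colouring, and U(sl2), which acts
  only for the undeformed one.\<close>

locale coset_rep =
  fixes I :: "(agen list \<Rightarrow> 'k::field_char_0) set" and \<psi> :: "nat \<Rightarrow> int \<Rightarrow> 'k fps"
  assumes ideal_I: "ideal I freealg"
    and ann_I: "\<And>f n v k. f \<in> I \<Longrightarrow> free_op \<psi> f n v k = 0"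
begin

abbreviation "Q \<equiv> freealg Quot I"
abbreviation "S \<equiv> series_ring Q"
abbreviation "sm \<equiv> qsmult freealg I fsmult"
abbreviation cl :: "(agen list \<Rightarrow> 'k) \<Rightarrow> (agen list \<Rightarrow> 'k) set" where
  "cl f \<equiv> I +>\<^bsub>freealg\<^esub> f"

interpretation I: ideal I freealg by (rule ideal_I)
sublocale Q: ring Q by (rule I.quotient_is_ring)
sublocale S: ring S by (rule Q.ring_series)

lemma carrier_Q: "C \<in> carrier Q \<longleftrightarrow> (\<exists>f\<in>carrier freealg. C = cl f)"
  by (auto simp: FactRing_def A_RCOSETS_def')

lemma cl_closed: "f \<in> carrier freealg \<Longrightarrow> cl f \<in> carrier Q"
  by (auto simp: carrier_Q)

lemma cl_mult: "f \<in> carrier freealg \<Longrightarrow> g \<in> carrier freealg \<Longrightarrow> cl f \<otimes>\<^bsub>Q\<^esub> cl g = cl (f \<otimes>\<^bsub>freealg\<^esub> g)"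
  by (simp add: ring_hom_mult[OF I.rcos_ring_hom])

lemma cl_add: "f \<in> carrier freealg \<Longrightarrow> g \<in> carrier freealg \<Longrightarrow> cl f \<oplus>\<^bsub>Q\<^esub> cl g = cl (f \<oplus>\<^bsub>freealg\<^esub> g)"
  by (simp add: ring_hom_add[OF I.rcos_ring_hom])

lemma cl_one: "\<one>\<^bsub>Q\<^esub> = cl (fword [])"
  using ring_hom_one[OF I.rcos_ring_hom] by (simp add: freealg_simps)

lemma cl_zero: "\<zero>\<^bsub>Q\<^esub> = cl (\<lambda>w. 0)"
  using ring_hom_zero[OF I.rcos_ring_hom ring_freealg Q.ring_axioms] by (simp add: freealg_simps)

lemma cl_eq_iff:
  "f \<in> carrier freealg \<Longrightarrow> g \<in> carrier freealg \<Longrightarrow> cl f = cl g \<longleftrightarrow> (\<lambda>w. f w - g w) \<in> I"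
  using freealg.quotient_eq_iff_same_a_r_cos[OF ideal_I, of f g] by (simp add: freealg_minus)

lemma fsmult_I: "f \<in> I \<Longrightarrow> fsmult c f \<in> I"
  by (subst fsmult_eq_mult) (simp add: I.I_l_closed fsmult_closed fword_closed)

text \<open>The chosen representative differs from f by an element of the ideal. All later uses of
  \<open>SOME\<close> on cosets of the free algebra are resolved by this.\<close>

lemma some_cl:
  assumes "f \<in> carrier freealg"
  shows "(SOME x. x \<in> cl f) \<in> carrier freealg" "cl (SOME x. x \<in> cl f) = cl f"
    "\<exists>i\<in>I. (SOME x. x \<in> cl f) = i \<oplus>\<^bsub>freealg\<^esub> f"
proof -
  have "f \<in> cl f" using I.a_rcos_self[OF assms] .
  then have x: "(SOME x. x \<in> cl f) \<in> cl f" by (rule someI[of "\<lambda>x. x \<in> cl f"])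
  then show ex: "\<exists>i\<in>I. (SOME x. x \<in> cl f) = i \<oplus>\<^bsub>freealg\<^esub> f"
    by (auto simp: a_r_coset_def')
  then show c: "(SOME x. x \<in> cl f) \<in> carrier freealg"
    using assms I.Icarr by auto
  show "cl (SOME x. x \<in> cl f) = cl f"
    using freealg.a_repr_independence[OF x assms I.is_additive_subgroup[THEN additive_subgroup.a_subgroup]] by simp
qed

lemma coset_op_cl: "f \<in> carrier freealg \<Longrightarrow> coset_op \<psi> (cl f) = free_op \<psi> f"
  using some_cl(3)[of f] by (auto simp: coset_op_def free_op_add I.Icarr ann_I intro!: ext)

lemma sm_cl:
  assumes f: "f \<in> carrier freealg"
  shows "sm c (cl f) = cl (fsmult c f)"
proof -
  obtain i where i: "i \<in> I" "(SOME x. x \<in> cl f) = i \<oplus>\<^bsub>freealg\<^esub> f"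
    using some_cl(3)[OF f] by auto
  have "(\<lambda>w. fsmult c (i \<oplus>\<^bsub>freealg\<^esub> f) w - fsmult c f w) = fsmult c i"
    by (simp add: fsmult_def freealg_simps ring_distribs)
  then show ?thesis unfolding qsmult_def i
    by (subst cl_eq_iff) (auto simp: i fsmult_closed f I.Icarr fsmult_I freealg_add_closed)
qed

lemma sm_closed: "C \<in> carrier Q \<Longrightarrow> sm c C \<in> carrier Q"
  by (auto simp: carrier_Q sm_cl intro: fsmult_closed)

lemma sm_0: "C \<in> carrier Q \<Longrightarrow> sm 0 C = \<zero>\<^bsub>Q\<^esub>"
  by (auto simp: carrier_Q sm_cl cl_zero fsmult_def)

lemma sm_1: "C \<in> carrier Q \<Longrightarrow> sm 1 C = C"
  by (auto simp: carrier_Q sm_cl fsmult_def)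

lemma coset_op_add:
  "C \<in> carrier Q \<Longrightarrow> D \<in> carrier Q \<Longrightarrow>
    coset_op \<psi> (C \<oplus>\<^bsub>Q\<^esub> D) n v k = coset_op \<psi> C n v k + coset_op \<psi> D n v k"
  by (auto simp: carrier_Q cl_add coset_op_cl free_op_add)

lemma coset_op_mult:
  "C \<in> carrier Q \<Longrightarrow> D \<in> carrier Q \<Longrightarrow>
    coset_op \<psi> (C \<otimes>\<^bsub>Q\<^esub> D) n v k = coset_op \<psi> C n (coset_op \<psi> D n v) k"
  by (auto simp: carrier_Q cl_mult coset_op_cl free_op_mult)

lemma coset_op_zero [simp]: "coset_op \<psi> \<zero>\<^bsub>Q\<^esub> n v k = 0"
proof -
  have "(\<lambda>w. 0 :: 'k) \<in> carrier freealg" by (simp add: freealg_simps)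
  then show ?thesis by (simp add: cl_zero coset_op_cl free_op_zero)
qed

lemma coset_op_one: "coset_op \<psi> \<one>\<^bsub>Q\<^esub> n v k = v k"
  by (simp add: cl_one coset_op_cl fword_closed free_op_fword)

lemma coset_op_finsum:
  assumes "finite J" "\<And>i. i \<in> J \<Longrightarrow> C i \<in> carrier Q"
  shows "coset_op \<psi> (finsum Q C J) n v k = (\<Sum>i\<in>J. coset_op \<psi> (C i) n v k)"
  using assms by (induction J rule: finite_induct) (simp_all add: coset_op_add Pi_def)

lemma coset_op_sm:
  "C \<in> carrier Q \<Longrightarrow> coset_op \<psi> (sm c C) n v k = fps_const c * coset_op \<psi> C n v k"
  by (auto simp: carrier_Q sm_cl coset_op_cl free_op_smult fsmult_closed)

lemma coset_op_hsum:
  "coset_op \<psi> C n (\<lambda>k. hsum (\<lambda>i. V i k)) k = hsum (\<lambda>i. coset_op \<psi> C n (V i) k)"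
  by (simp add: coset_op_def free_op_hsum)

lemma series_op_add:
  assumes "x \<in> carrier S" "y \<in> carrier S"
  shows "series_op \<psi> (x \<oplus>\<^bsub>S\<^esub> y) n v k = series_op \<psi> x n v k + series_op \<psi> y n v k"
  using assms by (simp add: series_simps series_op_def coset_op_add hsum_add)

lemma series_op_zero [simp]: "series_op \<psi> \<zero>\<^bsub>S\<^esub> n v k = 0"
  by (simp add: series_simps series_op_def)

lemma series_op_minus:
  assumes "x \<in> carrier S" "y \<in> carrier S"
  shows "series_op \<psi> (x \<ominus>\<^bsub>S\<^esub> y) n v k = series_op \<psi> x n v k - series_op \<psi> y n v k"
proof -
  have "x \<ominus>\<^bsub>S\<^esub> y \<oplus>\<^bsub>S\<^esub> y = x" using assms by (simp add: a_minus_def S.a_assoc S.l_neg)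
  then show ?thesis using series_op_add[of "x \<ominus>\<^bsub>S\<^esub> y" y n v k] assms by simp
qed

text \<open>The Cauchy product is regrouped by \<open>hsum_hsum\<close>; continuity of the left
  factor then lets it act on the whole series produced by the right factor.\<close>

lemma series_op_mult:
  assumes "x \<in> carrier S" "y \<in> carrier S"
  shows "series_op \<psi> (x \<otimes>\<^bsub>S\<^esub> y) n v k = series_op \<psi> x n (series_op \<psi> y n v) k"
proof -
  have "series_op \<psi> (x \<otimes>\<^bsub>S\<^esub> y) n v k
      = hsum (\<lambda>m. \<Sum>i\<le>m. coset_op \<psi> (x i) n (coset_op \<psi> (y (m - i)) n v) k)"
    using assms by (simp add: series_simps series_op_def coset_op_finsum coset_op_mult)
  also have "\<dots> = hsum (\<lambda>i. hsum (\<lambda>j. coset_op \<psi> (x i) n (coset_op \<psi> (y j) n v) k))"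
    by (rule hsum_hsum[symmetric])
  also have "\<dots> = series_op \<psi> x n (series_op \<psi> y n v) k"
    unfolding series_op_def[abs_def] by (subst coset_op_hsum) simp
  finally show ?thesis .
qed

lemma series_op_one: "series_op \<psi> \<one>\<^bsub>S\<^esub> n v k = v k"
proof -
  have "series_op \<psi> \<one>\<^bsub>S\<^esub> n v k = hsum (\<lambda>i. if i = 0 then v k else 0)"
    unfolding series_op_def series_simps by (rule arg_cong[of _ _ hsum]) (auto simp: coset_op_one)
  then show ?thesis by (simp add: hsum_single)
qed

lemma series_op_const: "series_op \<psi> (const_ser Q C) n v k = coset_op \<psi> C n v k"
proof -
  have "series_op \<psi> (const_ser Q C) n v k = hsum (\<lambda>i. if i = 0 then coset_op \<psi> C n v k else 0)"
    unfolding series_op_def const_ser_def by (rule arg_cong[of _ _ hsum]) auto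
  then show ?thesis by (simp add: hsum_single)
qed

lemma const_closed: "C \<in> carrier Q \<Longrightarrow> const_ser Q C \<in> carrier S"
  by (simp add: const_ser_def series_simps)

lemma ser_smult_closed: "x \<in> carrier S \<Longrightarrow> ser_smult Q sm c x \<in> carrier S"
  by (auto simp: ser_smult_def series_simps intro!: Q.finsum_closed sm_closed)

lemma series_op_smult:
  assumes "x \<in> carrier S"
  shows "series_op \<psi> (ser_smult Q sm c x) n v k = c * series_op \<psi> x n v k"
proof -
  have "series_op \<psi> (ser_smult Q sm c x) n v k
      = hsum (\<lambda>m. \<Sum>i\<le>m. fps_const (fps_nth c i) * coset_op \<psi> (x (m - i)) n v k)"
    using assms by (simp add: series_simps series_op_def ser_smult_def coset_op_finsum sm_closed coset_op_sm)
  also have "\<dots> = hsum (\<lambda>i. fps_const (fps_nth c i)) * series_op \<psi> x n v k"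
    unfolding hsum_hsum[symmetric, where T = "\<lambda>i j. fps_const (fps_nth c i) * coset_op \<psi> (x j) n v k"]
      hsum_cmult series_op_def
    by (simp add: hsum_cmult mult.commute[of _ "hsum (\<lambda>i. coset_op \<psi> (x i) n v k)"])
  also have "hsum (\<lambda>i. fps_const (fps_nth c i)) = c" by (rule hsum_fps_const)
  finally show ?thesis .
qed

lemma ser_smult_X:
  assumes "x \<in> carrier S"
  shows "ser_smult Q sm fps_X x = (\<lambda>m. if m = 0 then \<zero>\<^bsub>Q\<^esub> else x (m - 1))"
proof
  fix m
  have x: "x i \<in> carrier Q" for i using assms by (simp add: series_simps)
  show "ser_smult Q sm fps_X x m = (if m = 0 then \<zero>\<^bsub>Q\<^esub> else x (m - 1))"
  proof (cases "m = 0")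
    case False
    have "ser_smult Q sm fps_X x m = finsum Q (\<lambda>i. if 1 = i then x (m - i) else \<zero>\<^bsub>Q\<^esub>) {..m}"
      unfolding ser_smult_def by (rule Q.finsum_cong') (auto simp: x sm_0 sm_1)
    also have "\<dots> = x (m - 1)"
      using False x by (subst Q.add.finprod_singleton) auto
    finally show ?thesis using False by simp
  qed (simp add: ser_smult_def x sm_0)
qed

lemma series_split:
  assumes "x \<in> carrier S"
  shows "x = const_ser Q (x 0) \<oplus>\<^bsub>S\<^esub> ser_smult Q sm fps_X (\<lambda>m. x (Suc m))"
proof -
  have "(\<lambda>m. x (Suc m)) \<in> carrier S" using assms by (simp add: series_simps)
  then show ?thesis using assms
    by (auto simp: ser_smult_X) (auto simp: const_ser_def series_simps fun_eq_iff)
qed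

lemma ser_smult_const:
  assumes "C \<in> carrier Q"
  shows "ser_smult Q sm (fps_const c) (const_ser Q C) = const_ser Q (sm c C)"
proof
  fix m
  have z: "sm c \<zero>\<^bsub>Q\<^esub> = \<zero>\<^bsub>Q\<^esub>"
    using sm_cl[of "\<lambda>w. 0" c] by (simp add: cl_zero freealg_simps fsmult_def)
  have "ser_smult Q sm (fps_const c) (const_ser Q C) m
      = finsum Q (\<lambda>i. if 0 = i then const_ser Q (sm c C) m else \<zero>\<^bsub>Q\<^esub>) {..m}"
    unfolding ser_smult_def
    by (rule Q.finsum_cong') (use assms in \<open>auto simp: const_ser_def z sm_0 sm_closed\<close>)
  also have "\<dots> = const_ser Q (sm c C) m"
    using assms by (subst Q.add.finprod_singleton) (auto simp: const_ser_def sm_closed)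
  finally show "ser_smult Q sm (fps_const c) (const_ser Q C) m = const_ser Q (sm c C) m" .
qed

lemma const_ser_add:
  "C \<in> carrier Q \<Longrightarrow> D \<in> carrier Q \<Longrightarrow> const_ser Q (C \<oplus>\<^bsub>Q\<^esub> D) = const_ser Q C \<oplus>\<^bsub>S\<^esub> const_ser Q D"
  by (auto simp: const_ser_def series_simps fun_eq_iff)

lemma const_ser_mult:
  assumes "C \<in> carrier Q" "D \<in> carrier Q"
  shows "const_ser Q (C \<otimes>\<^bsub>Q\<^esub> D) = const_ser Q C \<otimes>\<^bsub>S\<^esub> const_ser Q D"
proof
  fix m
  have "(const_ser Q C \<otimes>\<^bsub>S\<^esub> const_ser Q D) m
      = finsum Q (\<lambda>i. if 0 = i then const_ser Q (C \<otimes>\<^bsub>Q\<^esub> D) m else \<zero>\<^bsub>Q\<^esub>) {..m}"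
    unfolding series_simps
    by (rule Q.finsum_cong') (use assms in \<open>auto simp: const_ser_def\<close>)
  also have "\<dots> = const_ser Q (C \<otimes>\<^bsub>Q\<^esub> D) m"
    using assms by (subst Q.add.finprod_singleton) (auto simp: const_ser_def)
  finally show "const_ser Q (C \<otimes>\<^bsub>Q\<^esub> D) m = (const_ser Q C \<otimes>\<^bsub>S\<^esub> const_ser Q D) m" ..
qed

lemma const_ser_one: "const_ser Q \<one>\<^bsub>Q\<^esub> = \<one>\<^bsub>S\<^esub>"
  by (auto simp: const_ser_def series_simps)

end

text \<open>Since the kernel is an ideal, a generated ideal acts by zero as soon as its generating
  relations do.\<close>

lemma ideal_free_op_kernel:
  "ideal {f \<in> carrier freealg. \<forall>n v k. free_op \<psi> f n v k = 0} freealg" (is "ideal ?K _")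
proof (rule idealI[OF ring_freealg])
  have inv: "\<ominus>\<^bsub>freealg\<^esub> f = \<zero>\<^bsub>freealg\<^esub> \<ominus>\<^bsub>freealg\<^esub> f" if "f \<in> carrier freealg" for f :: "agen list \<Rightarrow> 'a"
    using that by (simp add: a_minus_def)
  show "subgroup ?K (add_monoid freealg)"
  proof (rule freealg.add.subgroupI)
    show "?K \<noteq> {}" using freealg.zero_closed free_op_zero[of \<psi>] unfolding freealg_simps(4) by blast
  next
    fix a assume "a \<in> ?K"
    then show "\<ominus>\<^bsub>freealg\<^esub> a \<in> ?K"
      using free_op_zero[of \<psi>]
      by (auto simp: inv free_op_minus) (simp add: freealg_simps)
  qed (auto simp: free_op_add)
next
  fix a x :: "agen list \<Rightarrow> 'a" assume a: "a \<in> ?K" and x: "x \<in> carrier freealg"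
  have "free_op \<psi> a n v = (\<lambda>k. 0)" for n v using a by auto
  moreover have "free_op \<psi> x n (\<lambda>k. 0) k = 0" for n k
    using free_op_cmult[of \<psi> x n 0 "\<lambda>k. 0"] by (simp add: fun_eq_iff)
  ultimately show "x \<otimes>\<^bsub>freealg\<^esub> a \<in> ?K" "a \<otimes>\<^bsub>freealg\<^esub> x \<in> ?K"
    using a x by (simp_all add: free_op_mult)
qed

lemma rel_eq: "rel_Hp = fword [GH,GXp] \<ominus>\<^bsub>freealg\<^esub> fword [GXp,GH] \<ominus>\<^bsub>freealg\<^esub> fsmult 2 (fword [GXp])"
  "rel_Hm = fword [GH,GXm] \<ominus>\<^bsub>freealg\<^esub> fword [GXm,GH] \<oplus>\<^bsub>freealg\<^esub> fsmult 2 (fword [GXm])"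
  "rel_pm = fword [GXp,GXm] \<ominus>\<^bsub>freealg\<^esub> fword [GXm,GXp] \<ominus>\<^bsub>freealg\<^esub> fword [GH]"
  by (simp_all add: freealg_minus[OF freealg.minus_closed] fword_closed fsmult_closed)
    (simp_all add: freealg_minus freealg_simps(5) fword_closed rel_Hp_def rel_Hm_def rel_pm_def fsmult_def)

lemma rel_closed: "rel_Hp \<in> carrier freealg" "rel_Hm \<in> carrier freealg" "rel_pm \<in> carrier freealg"
  unfolding rel_eq by (simp_all add: fword_closed fsmult_closed)

section \<open>Faithfulness of the Verma modules of \<open>sl\<^sub>2\<close>\<close>

definition sl2_col :: "nat \<Rightarrow> int \<Rightarrow> 'k::field_char_0 fps" where
  "sl2_col k n = fps_const (of_nat k * (of_int n - of_nat k + 1))"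

text \<open>Only the shift of the index by X^+ and X^- enters, not the coefficient of X^+. Hence the
  relations of a hold for every \<psi>.\<close>

lemma free_op_rel_H: "free_op \<psi> rel_Hp n v k = 0" "free_op \<psi> rel_Hm n v k = 0"
proof -
  \<comment> \<open>Neighbouring weights differ by 2.\<close>
  have c: "fps_const (of_int n - 2 * of_nat k) = fps_const (of_int n - 2 * of_nat (Suc k)) + fps_const (2::'a)" for k
    by (simp add: algebra_simps)
  show "free_op \<psi> rel_Hp n v k = 0"
    unfolding rel_eq
    by (simp add: free_op_minus free_op_smult free_op_fword fword_closed fsmult_closed gen_op_def
        del: of_nat_Suc fps_const_sub fps_const_add) (simp only: c[of k] ring_distribs, simp add: mult_ac)
  show "free_op \<psi> rel_Hm n v k = 0"
    unfolding rel_eq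
  proof (cases k)
    case (Suc j)
    then show "free_op \<psi> (fword [GH, GXm] \<ominus>\<^bsub>freealg\<^esub> fword [GXm, GH] \<oplus>\<^bsub>freealg\<^esub> fsmult 2 (fword [GXm])) n v k = 0"
      by (simp add: free_op_minus free_op_add free_op_smult free_op_fword fword_closed
          fsmult_closed gen_op_def del: of_nat_Suc fps_const_add fps_const_sub)
        (simp only: c[of j] ring_distribs, simp)
  qed (simp add: free_op_minus free_op_add free_op_smult free_op_fword fword_closed fsmult_closed gen_op_def)
qed

text \<open>The identity behind this is (k + 1)(n - k) - k(n - k + 1) = n - 2k; at k = 0 the second
  product vanishes, as X^- X^+ b_0 does.\<close>

lemma free_op_rel_pm: "free_op sl2_col rel_pm n v k = 0"
  unfolding rel_eq
  by (simp add: free_op_minus free_op_fword fword_closed gen_op_def sl2_col_def fps_eq_iff)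
    (auto simp: algebra_simps)

interpretation Ua: coset_rep I_a \<psi> for \<psi> :: "nat \<Rightarrow> int \<Rightarrow> 'k::field_char_0 fps"
proof (rule coset_rep.intro)
  show "ideal (I_a :: (agen list \<Rightarrow> 'k) set) freealg"
    unfolding I_a_def by (rule freealg.genideal_ideal) (simp add: rel_closed)
  then show "free_op \<psi> f n v k = 0" if "f \<in> I_a" for f n v k
    using that freealg.genideal_minimal[OF ideal_free_op_kernel[of \<psi>], of "{rel_Hp, rel_Hm}"]
    by (auto simp: I_a_def rel_closed free_op_rel_H)
qed

interpretation sl2: coset_rep I_sl2 "sl2_col :: nat \<Rightarrow> int \<Rightarrow> 'k::field_char_0 fps"
proof (rule coset_rep.intro)
  show "ideal (I_sl2 :: (agen list \<Rightarrow> 'k) set) freealg"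
    unfolding I_sl2_def by (rule freealg.genideal_ideal) (simp add: rel_closed)
  then show "free_op sl2_col f n v k = 0" if "f \<in> I_sl2" for f :: "agen list \<Rightarrow> 'k" and n v k
    using that freealg.genideal_minimal[OF ideal_free_op_kernel[of sl2_col], of "{rel_Hp, rel_Hm, rel_pm}"]
    by (auto simp: I_sl2_def rel_closed free_op_rel_H free_op_rel_pm)
qed

section \<open>PBW words span U(sl2)\<close>

definition pbw_word :: "nat \<Rightarrow> nat \<Rightarrow> nat \<Rightarrow> agen list" where
  "pbw_word a b c = replicate a GXm @ replicate b GH @ replicate c GXp"

text \<open>Membership provides a lift to the free algebra supported on PBW words;
  \<open>pbw_independent\<close> is later applied to this lift.\<close>

definition pbw_span :: "(agen list \<Rightarrow> 'k::field_char_0) set set" where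
  "pbw_span = {sl2.cl f | f. f \<in> carrier freealg \<and> (\<forall>w. f w \<noteq> 0 \<longrightarrow> (\<exists>a b c. w = pbw_word a b c))}"

lemma pbw_span_word: "sl2.cl (fword (pbw_word a b c)) \<in> pbw_span"
proof -
  have "\<forall>w. fword (pbw_word a b c) w \<noteq> (0::'a) \<longrightarrow> (\<exists>a b c. w = pbw_word a b c)"
    by (auto simp: fword_def)
  then show ?thesis unfolding pbw_span_def using fword_closed by blast
qed

lemma pbw_span_add:
  assumes "C \<in> pbw_span" "D \<in> pbw_span"
  shows "C \<oplus>\<^bsub>sl2.Q\<^esub> D \<in> pbw_span"
proof -
  obtain f g where f: "f \<in> carrier freealg" "\<And>w. f w \<noteq> 0 \<Longrightarrow> \<exists>a b c. w = pbw_word a b c" "C = sl2.cl f"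
    and g: "g \<in> carrier freealg" "\<And>w. g w \<noteq> 0 \<Longrightarrow> \<exists>a b c. w = pbw_word a b c" "D = sl2.cl g"
    using assms unfolding pbw_span_def by blast
  have "\<exists>a b c. w = pbw_word a b c" if "(f \<oplus>\<^bsub>freealg\<^esub> g) w \<noteq> 0" for w
    using that f(2)[of w] g(2)[of w] by (cases "f w = 0") (auto simp: freealg_simps)
  moreover have "C \<oplus>\<^bsub>sl2.Q\<^esub> D = sl2.cl (f \<oplus>\<^bsub>freealg\<^esub> g)" by (simp add: f g sl2.cl_add)
  ultimately show ?thesis using freealg_add_closed[OF f(1) g(1)] unfolding pbw_span_def by blast
qed

lemma pbw_span_sm:
  assumes "C \<in> pbw_span"
  shows "sl2.sm x C \<in> pbw_span"
proof -
  obtain f where f: "f \<in> carrier freealg" "\<And>w. f w \<noteq> 0 \<Longrightarrow> \<exists>a b c. w = pbw_word a b c" "C = sl2.cl f"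
    using assms unfolding pbw_span_def by blast
  have "\<exists>a b c. w = pbw_word a b c" if "fsmult x f w \<noteq> 0" for w
    using that f(2)[of w] by (auto simp: fsmult_def)
  moreover have "sl2.sm x C = sl2.cl (fsmult x f)" by (simp add: f sl2.sm_cl)
  ultimately show ?thesis using fsmult_closed[OF f(1)] unfolding pbw_span_def by blast
qed

lemma pbw_span_zero: "\<zero>\<^bsub>sl2.Q\<^esub> \<in> pbw_span"
  unfolding pbw_span_def sl2.cl_zero by (auto intro!: exI[of _ "\<lambda>w. 0"] simp: freealg_simps)

abbreviation scl :: "agen list \<Rightarrow> (agen list \<Rightarrow> 'k::field_char_0) set" where
  "scl w \<equiv> sl2.cl (fword w)"

text \<open>By linearity, only products of a generator with a single PBW word have to be
  straightened.\<close>

lemma pbw_span_left: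
  fixes C :: "(agen list \<Rightarrow> 'k::field_char_0) set"
  assumes C: "C \<in> pbw_span"
    and g: "\<And>a b c. (scl (g # pbw_word a b c) :: (agen list \<Rightarrow> 'k) set) \<in> pbw_span"
  shows "scl [g] \<otimes>\<^bsub>sl2.Q\<^esub> C \<in> pbw_span"
proof -
  obtain f where f: "f \<in> carrier freealg" "{w. f w \<noteq> 0} \<subseteq> {pbw_word a b c | a b c. True}" "C = sl2.cl f"
    using C unfolding pbw_span_def by blast
  from f(1,2) show ?thesis unfolding f(3)
  proof (induction f rule: freealg_induct)
    case zero
    then show ?case using pbw_span_zero
      by (simp add: sl2.cl_zero[symmetric] sl2.cl_closed fword_closed)
  next
    case (add f c w)
    have "scl [g] \<otimes>\<^bsub>sl2.Q\<^esub> sl2.cl (f \<oplus>\<^bsub>freealg\<^esub> fsmult c (fword w))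
      = scl [g] \<otimes>\<^bsub>sl2.Q\<^esub> sl2.cl f \<oplus>\<^bsub>sl2.Q\<^esub> sl2.sm c (scl (g # w))"
      using add(1) by (simp add: sl2.cl_mult sl2.cl_add sl2.sm_cl fword_closed fsmult_closed
          freealg.r_distr fsmult_mult_right fword_mult)
    moreover have "sl2.sm c (scl (g # w) :: (agen list \<Rightarrow> 'k) set) \<in> pbw_span" using add.hyps(2) g by (auto intro: pbw_span_sm)
    ultimately show ?case using pbw_span_add[OF add.IH] by simp
  qed
qed

lemma scl_closed: "scl w \<in> carrier sl2.Q"
  by (rule sl2.cl_closed) (rule fword_closed)

lemma scl_Cons: "scl (g # w) = scl [g] \<otimes>\<^bsub>sl2.Q\<^esub> scl w"
  by (simp add: sl2.cl_mult fword_closed fword_mult)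

text \<open>Straightening rules: a pair out of the order X^-, H, X^+ is replaced by the ordered pair
  plus a shorter word.\<close>

lemma scl_rel:
  "scl (GXp # GH # w) = (scl (GH # GXp # w) \<oplus>\<^bsub>sl2.Q\<^esub> sl2.sm (-2) (scl (GXp # w)) :: (agen list \<Rightarrow> 'b::field_char_0) set)"
  "scl (GH # GXm # w) = (scl (GXm # GH # w) \<oplus>\<^bsub>sl2.Q\<^esub> sl2.sm (-2) (scl (GXm # w)) :: (agen list \<Rightarrow> 'b) set)"
  "scl (GXp # GXm # w) = (scl (GXm # GXp # w) \<oplus>\<^bsub>sl2.Q\<^esub> scl (GH # w) :: (agen list \<Rightarrow> 'b) set)"
proof -
  have gen: "r \<in> I_sl2" if "r \<in> {rel_Hp, rel_Hm, rel_pm}" for r :: "agen list \<Rightarrow> 'b"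
    using that freealg.genideal_self[of "{rel_Hp, rel_Hm, rel_pm}"] rel_closed
    unfolding I_sl2_def by blast
  have m: "rel_Hp \<otimes>\<^bsub>freealg\<^esub> fword w
      = (\<lambda>x. fword (GH # GXp # w) x - fword (GXp # GH # w) x - 2 * fword (GXp # w) x :: 'b)"
    "rel_Hm \<otimes>\<^bsub>freealg\<^esub> fword w
      = (\<lambda>x. fword (GH # GXm # w) x - fword (GXm # GH # w) x + 2 * fword (GXm # w) x :: 'b)"
    "rel_pm \<otimes>\<^bsub>freealg\<^esub> fword w
      = (\<lambda>x. fword (GXp # GXm # w) x - fword (GXm # GXp # w) x - fword (GH # w) x :: 'b)"
    for w
    using fword_mult[of "[GH, GXp]" w, where 'k = 'b] fword_mult[of "[GXp, GH]" w, where 'k = 'b]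
      fword_mult[of "[GH, GXm]" w, where 'k = 'b] fword_mult[of "[GXm, GH]" w, where 'k = 'b]
      fword_mult[of "[GXp, GXm]" w, where 'k = 'b] fword_mult[of "[GXm, GXp]" w, where 'k = 'b]
      fword_mult[of "[GXp]" w, where 'k = 'b] fword_mult[of "[GXm]" w, where 'k = 'b]
      fword_mult[of "[GH]" w, where 'k = 'b]
    by (simp_all add: freealg_simps(2) rel_Hp_def rel_Hm_def rel_pm_def fun_eq_iff sum_subtractf
        sum.distrib ring_distribs sum_distrib_left mult.assoc flip: sum_distrib_left)
  have c: "fsmult x (r \<otimes>\<^bsub>freealg\<^esub> fword w) \<in> I_sl2" if "r \<in> {rel_Hp, rel_Hm, rel_pm}" for x and r :: "agen list \<Rightarrow> 'b"
    using gen[OF that] by (intro sl2.fsmult_I ideal.I_r_closed[OF sl2.ideal_I] fword_closed)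
  note [simp] = fword_closed fsmult_closed freealg_add_closed
  show "scl (GXp # GH # w) = (scl (GH # GXp # w) \<oplus>\<^bsub>sl2.Q\<^esub> sl2.sm (-2) (scl (GXp # w)) :: (agen list \<Rightarrow> 'b) set)"
    using c[of rel_Hp "-1"] unfolding m
    by (simp add: sl2.sm_cl sl2.cl_add sl2.cl_eq_iff) (simp add: fsmult_def freealg_simps algebra_simps)
  show "scl (GH # GXm # w) = (scl (GXm # GH # w) \<oplus>\<^bsub>sl2.Q\<^esub> sl2.sm (-2) (scl (GXm # w)) :: (agen list \<Rightarrow> 'b) set)"
    using c[of rel_Hm 1] unfolding m
    by (simp add: sl2.sm_cl sl2.cl_add sl2.cl_eq_iff) (simp add: fsmult_def freealg_simps algebra_simps)
  show "scl (GXp # GXm # w) = (scl (GXm # GXp # w) \<oplus>\<^bsub>sl2.Q\<^esub> scl (GH # w) :: (agen list \<Rightarrow> 'b) set)"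
    using c[of rel_pm 1] unfolding m
    by (simp add: sl2.sm_cl sl2.cl_add sl2.cl_eq_iff) (simp add: fsmult_def freealg_simps algebra_simps)
qed

lemma pbw_span_Xm:
  fixes C :: "(agen list \<Rightarrow> 'k::field_char_0) set"
  shows "C \<in> pbw_span \<Longrightarrow> scl [GXm] \<otimes>\<^bsub>sl2.Q\<^esub> C \<in> pbw_span"
proof (erule pbw_span_left)
  fix a b c
  show "(scl (GXm # pbw_word a b c) :: (agen list \<Rightarrow> 'k) set) \<in> pbw_span"
    using pbw_span_word[of "Suc a" b c] by (simp add: pbw_word_def)
qed

text \<open>H is moved to the right past one X^- at a time. The X^- left in front is absorbed by
  \<open>pbw_span_Xm\<close>, so the generators have to be treated in the order X^-, H, X^+.\<close>

lemma pbw_span_H: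
  fixes C :: "(agen list \<Rightarrow> 'k::field_char_0) set"
  shows "C \<in> pbw_span \<Longrightarrow> scl [GH] \<otimes>\<^bsub>sl2.Q\<^esub> C \<in> pbw_span"
proof (erule pbw_span_left)
  fix a b c
  show "(scl (GH # pbw_word a b c) :: (agen list \<Rightarrow> 'k) set) \<in> pbw_span"
  proof (induction a)
    case 0
    show ?case using pbw_span_word[of 0 "Suc b" c] by (simp add: pbw_word_def)
  next
    case (Suc a)
    have w: "pbw_word (Suc a) b c = GXm # pbw_word a b c" by (simp add: pbw_word_def)
    have "(scl (GXm # GH # pbw_word a b c) :: (agen list \<Rightarrow> 'k) set) \<in> pbw_span"
      by (subst scl_Cons) (rule pbw_span_Xm[OF Suc])
    then show ?case unfolding w scl_rel
      by (intro pbw_span_add pbw_span_sm) (auto simp: pbw_span_word w[symmetric])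
  qed
qed

text \<open>X^+ first passes the letters X^- (outer induction) and then the letters H (inner
  induction). The correction terms are again covered by the cases of X^- and H.\<close>

lemma pbw_span_Xp:
  fixes C :: "(agen list \<Rightarrow> 'k::field_char_0) set"
  shows "C \<in> pbw_span \<Longrightarrow> scl [GXp] \<otimes>\<^bsub>sl2.Q\<^esub> C \<in> pbw_span"
proof (erule pbw_span_left)
  fix a b c
  show "(scl (GXp # pbw_word a b c) :: (agen list \<Rightarrow> 'k) set) \<in> pbw_span"
  proof (induction a)
    case 0
    show ?case
    proof (induction b)
      case 0
      show ?case using pbw_span_word[of 0 0 "Suc c"] by (simp add: pbw_word_def)
    next
      case (Suc b)
      have w: "pbw_word 0 (Suc b) c = GH # pbw_word 0 b c" by (simp add: pbw_word_def)
      have "(scl (GH # GXp # pbw_word 0 b c) :: (agen list \<Rightarrow> 'k) set) \<in> pbw_span"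
        by (subst scl_Cons) (rule pbw_span_H[OF Suc])
      then show ?case unfolding w scl_rel by (intro pbw_span_add pbw_span_sm Suc)
    qed
  next
    case (Suc a)
    have w: "pbw_word (Suc a) b c = GXm # pbw_word a b c" by (simp add: pbw_word_def)
    have "(scl (GXm # GXp # pbw_word a b c) :: (agen list \<Rightarrow> 'k) set) \<in> pbw_span"
      by (subst scl_Cons) (rule pbw_span_Xm[OF Suc])
    moreover have "(scl (GH # pbw_word a b c) :: (agen list \<Rightarrow> 'k) set) \<in> pbw_span"
      by (subst scl_Cons) (rule pbw_span_H[OF pbw_span_word])
    ultimately show ?case unfolding w scl_rel by (intro pbw_span_add)
  qed
qed

lemma pbw_span_all:
  assumes f: "f \<in> carrier freealg"
  shows "sl2.cl f \<in> pbw_span"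
proof -
  have w: "scl w \<in> pbw_span" for w
  proof (induction w)
    case Nil
    show ?case using pbw_span_word[of 0 0 0] by (simp add: pbw_word_def)
  next
    case (Cons g w)
    then show ?case
      by (subst scl_Cons, cases g) (auto intro: pbw_span_Xm pbw_span_Xp pbw_span_H)
  qed
  from f subset_UNIV show ?thesis
  proof (induction f rule: freealg_induct)
    case zero
    then show ?case using pbw_span_zero by (simp add: sl2.cl_zero)
  next
    case (add f c x)
    then show ?case using w[of x]
      by (auto simp: sl2.cl_add[symmetric] sl2.sm_cl[symmetric] fword_closed fsmult_closed
          intro!: pbw_span_add pbw_span_sm)
  qed
qed

section \<open>Independence of PBW words on Verma modules\<close>

definition basis_vec :: "nat \<Rightarrow> nat \<Rightarrow> 'k::field_char_0 fps" where
  "basis_vec k = (\<lambda>j. if j = k then 1 else 0)"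

lemma pbw_word_inject: "pbw_word a b c = pbw_word a' b' c' \<longleftrightarrow> a = a' \<and> b = b' \<and> c = c'"
proof
  assume e: "pbw_word a b c = pbw_word a' b' c'"
  have "length (filter ((=) GXm) (pbw_word a b c)) = a" "length (filter ((=) GH) (pbw_word a b c)) = b"
    "length (filter ((=) GXp) (pbw_word a b c)) = c" for a b c
    by (simp_all add: pbw_word_def)
  then show "a = a' \<and> b = b' \<and> c = c'" using e by metis
qed simp

lemma word_op_replicate:
  "word_op \<psi> (replicate a GXm) n v k = (if k < a then 0 else v (k - a))"
  "word_op \<psi> (replicate b GH) n v k = fps_const (of_int n - 2 * of_nat k) ^ b * v k"
  "word_op \<psi> (replicate c GXp) n (basis_vec l) k
    = (if k + c = l then \<Prod>i<c. \<psi> (l - i) n else 0)"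
proof -
  show "word_op \<psi> (replicate a GXm) n v k = (if k < a then 0 else v (k - a))"
    by (induction a arbitrary: k) (auto simp: gen_op_def)
  show "word_op \<psi> (replicate b GH) n v k = fps_const (of_int n - 2 * of_nat k) ^ b * v k"
    by (induction b) (auto simp: gen_op_def)
  show "word_op \<psi> (replicate c GXp) n (basis_vec l) k
    = (if k + c = l then \<Prod>i<c. \<psi> (l - i) n else 0)"
    by (induction c arbitrary: k) (auto simp: gen_op_def basis_vec_def)
qed

text \<open>At least l factors X^+ kill b_l unless there are exactly l of them, when the result is a
  multiple of b_0. There H is the scalar n, and X^- then moves b_0 to b_a.\<close>

lemma word_op_pbw:
  assumes "l \<le> c"
  shows "word_op \<psi> (pbw_word a b c) n (basis_vec l) k
    = (if a = k \<and> c = l then of_int n ^ b * (\<Prod>i<l. \<psi> (l - i) n) else 0)"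
  using assms by (auto simp: pbw_word_def word_op_append word_op_replicate fps_of_int)

text \<open>Among the PBW words in the support take one with the least number \<open>c\<close> of factors \<open>X\<^sup>+\<close>.
  On \<open>b\<^sub>c\<close> only words with exactly \<open>c\<close> such factors survive, and the coefficient
  of each \<open>b\<^sub>a\<close> in the result is a nonzero multiple of a polynomial in the weight \<open>n\<close>.\<close>

lemma pbw_independent:
  fixes f :: "agen list \<Rightarrow> 'k::field_char_0"
  assumes f: "f \<in> carrier freealg" and pbw: "\<And>w. f w \<noteq> 0 \<Longrightarrow> \<exists>a b c. w = pbw_word a b c"
    and zero: "\<And>n l k. free_op sl2_col f n (basis_vec l) k = 0"
  shows "f = (\<lambda>w. 0)"
proof (rule ccontr)
  assume "f \<noteq> (\<lambda>w. 0)"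
  then have ex: "\<exists>c a b. f (pbw_word a b c) \<noteq> 0" using pbw by (metis ext)
  define c where "c = (LEAST c. \<exists>a b. f (pbw_word a b c) \<noteq> 0)"
  obtain a b where ab: "f (pbw_word a b c) \<noteq> 0" using LeastI_ex[OF ex] unfolding c_def by auto
  have min: "c \<le> c'" if "f (pbw_word a' b' c') \<noteq> 0" for a' b' c'
    unfolding c_def by (rule Least_le) (use that in blast)
  define J where "J = {b'. f (pbw_word a b' c) \<noteq> 0}"
  have fin: "finite {w. f w \<noteq> 0}" using f by (simp add: freealg_simps)
  have inj: "inj_on (\<lambda>b'. pbw_word a b' c) J" by (auto simp: inj_on_def pbw_word_inject)
  have J: "finite J"
    by (rule finite_imageD[OF finite_subset[OF _ fin] inj]) (auto simp: J_def)
  \<comment> \<open>For fixed a and c, the coefficient of b_a in the image of b_c is p(n) times the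
    scalar K by which X^+ to the power c takes b_c to b_0.\<close>
  define p where "p = (\<Sum>b'\<in>J. Polynomial.monom (f (pbw_word a b' c)) b')"
  have root: "poly p (of_nat (c + l)) = 0" for l
  proof -
    \<comment> \<open>With n >= c, each factor of K becomes (c - i)(l + i + 1), a positive integer,
      so K can be cancelled in characteristic zero.\<close>
    define n where "n = int (c + l)"
    define K where "K = (\<Prod>i<c. of_nat (c - i) * (of_int n - of_nat (c - i) + 1 :: 'k))"
    have "K \<noteq> 0"
    proof -
      have "K = (\<Prod>i<c. of_nat ((c - i) * (l + i + 1)))"
        unfolding K_def by (rule prod.cong) (simp_all add: n_def of_nat_diff ring_distribs)
      also have "\<dots> = of_nat (\<Prod>i<c. (c - i) * (l + i + 1))" by (rule of_nat_prod[symmetric])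
      also have "\<dots> \<noteq> 0" unfolding of_nat_eq_0_iff by auto
      finally show ?thesis .
    qed
    have K: "(\<Prod>i<c. sl2_col (c - i) n) = fps_const K"
    proof -
      have "(\<Prod>i\<in>A. fps_const (h i)) = fps_const (\<Prod>i\<in>A. h i)" for h :: "nat \<Rightarrow> 'k" and A
        by (induction A rule: infinite_finite_induct) auto
      then show ?thesis by (simp add: sl2_col_def K_def)
    qed
    have "0 = free_op sl2_col f n (basis_vec c) a" by (simp add: zero)
    also have "\<dots> = (\<Sum>w\<in>{w. f w \<noteq> 0}. fps_const (f w) * word_op sl2_col w n (basis_vec c) a)"
      by (simp add: free_op_def word_sum_def)
    also have "\<dots> = (\<Sum>w\<in>(\<lambda>b'. pbw_word a b' c) ` J. fps_const (f w) * word_op sl2_col w n (basis_vec c) a)"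
    proof (rule sum.mono_neutral_right[OF fin])
      show "\<forall>w\<in>{w. f w \<noteq> 0} - (\<lambda>b'. pbw_word a b' c) ` J.
          fps_const (f w) * word_op sl2_col w n (basis_vec c) a = 0"
      proof
        fix w assume w: "w \<in> {w. f w \<noteq> 0} - (\<lambda>b'. pbw_word a b' c) ` J"
        then obtain a' b' c' where "w = pbw_word a' b' c'" using pbw by blast
        \<comment> \<open>Here c' > c kills b_c, while c' = c with a' different from a lands on
          another basis vector.\<close>
        then show "fps_const (f w) * word_op sl2_col w n (basis_vec c) a = 0"
          using w min[of a' b' c'] by (auto simp: word_op_pbw J_def)
      qed
    qed (auto simp: J_def)
    also have "\<dots> = (\<Sum>b'\<in>J. fps_const (f (pbw_word a b' c) * (of_int n ^ b' * K)))"
      by (simp add: sum.reindex[OF inj] word_op_pbw K fps_of_int[symmetric] fps_const_power)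
    also have "fps_nth \<dots> 0 = (\<Sum>b'\<in>J. f (pbw_word a b' c) * (of_int n ^ b' * K))"
      by (simp add: fps_sum_nth)
    also have "\<dots> = poly p (of_int n) * K"
      by (simp add: p_def poly_sum poly_monom sum_distrib_right mult.assoc)
    finally show ?thesis using \<open>K \<noteq> 0\<close> by (simp add: n_def)
  qed
  have "p = 0"
  proof (rule ccontr)
    assume "p \<noteq> 0"
    then have "finite {x. poly p x = 0}" by (rule poly_roots_finite)
    moreover have "range (\<lambda>l. of_nat (c + l)) \<subseteq> {x. poly p x = 0}" using root by auto
    moreover have "inj (\<lambda>l. of_nat (c + l) :: 'k)" by (auto simp: inj_on_def)
    ultimately show False using finite_imageD finite_subset infinite_UNIV_nat by blast
  qed
  moreover have "Polynomial.coeff p b = f (pbw_word a b c)"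
    using J ab by (simp add: p_def coeff_sum J_def)
  ultimately show False using ab by simp
qed

lemma sl2_faithful:
  assumes f: "f \<in> carrier freealg"
    and zero: "\<And>n l k. free_op sl2_col f n (basis_vec l) k = 0"
  shows "f \<in> I_sl2"
proof -
  obtain f' where f': "f' \<in> carrier freealg" "\<And>w. f' w \<noteq> 0 \<Longrightarrow> \<exists>a b c. w = pbw_word a b c"
    and eq: "sl2.cl f = sl2.cl f'"
    using pbw_span_all[OF f] unfolding pbw_span_def by blast
  have "free_op sl2_col f' n (basis_vec l) k = 0" for n l k
    using zero[of n l k] sl2.coset_op_cl[OF f] sl2.coset_op_cl[OF f'(1)] eq by metis
  then have "f' = (\<lambda>w. 0)" using pbw_independent[OF f'] by blast
  then show ?thesis using eq f f'(1) by (simp add: sl2.cl_eq_iff)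
qed

section \<open>Symmetric bivariate polynomials\<close>

definition bipoly :: "'k::field_char_0 poly poly \<Rightarrow> 'k \<Rightarrow> 'k \<Rightarrow> 'k" where
  "bipoly P x y = poly (poly P [:y:]) x"

lemma bipoly_simps [simp]:
  "bipoly 0 x y = 0" "bipoly (A + B) x y = bipoly A x y + bipoly B x y"
  "bipoly (A * B) x y = bipoly A x y * bipoly B x y"
  "bipoly (A - B) x y = bipoly A x y - bipoly B x y"
  "bipoly (pCons a A) x y = poly a x + y * bipoly A x y"
  by (simp_all add: bipoly_def)

text \<open>Restricting to a curve y = q(x) gives a one-variable polynomial. Vanishing on the curve
  thus becomes divisibility by y - q(x).\<close>

lemma bipoly_poly: "poly (poly A q) x = bipoly A x (poly q x)"
  by (induction A) simp_all

text \<open>A change of variables yields a polynomial again, so that \<open>bipoly_eq_0_grid\<close>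
  applies to it.\<close>

lemma bipoly_subst:
  "\<exists>R. \<forall>s t. bipoly R s t = bipoly P (bipoly X s t) (bipoly Y s t)"
proof (induction P)
  case 0
  show ?case by (rule exI[of _ 0]) simp
next
  case (pCons a P)
  have "\<exists>R. \<forall>s t. bipoly R s t = poly a (bipoly X s t)"
  proof (induction a)
    case 0
    show ?case by (rule exI[of _ 0]) simp
  next
    case (pCons c a)
    then obtain R where "\<And>s t. bipoly R s t = poly a (bipoly X s t)" by blast
    then show ?case by (intro exI[of _ "[:[:c:]:] + X * R"]) simp
  qed
  then obtain R where "\<And>s t. bipoly R s t = poly a (bipoly X s t)" by blast
  moreover obtain R' where "\<And>s t. bipoly R' s t = bipoly P (bipoly X s t) (bipoly Y s t)"
    using pCons by blast
  ultimately show ?case by (intro exI[of _ "R + Y * R'"]) simp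
qed

lemma poly_eq_0_infinite:
  fixes p :: "'a::idom poly"
  assumes "inj h" "\<And>i::nat. poly p (h i) = 0"
  shows "p = 0"
proof (rule ccontr)
  assume "p \<noteq> 0"
  then have "finite (range h)"
    using poly_roots_finite[of p] by (rule_tac finite_subset[of _ "{x. poly p x = 0}"]) (auto simp: assms)
  then show False using finite_imageD[OF _ \<open>inj h\<close>] infinite_UNIV_nat by blast
qed

text \<open>The variables are eliminated one after the other, each time by infinitely many roots
  over an integral domain. The first argument starts at 1 because colourings are constrained only
  for k >= 1.\<close>

lemma bipoly_eq_0_grid:
  assumes "\<And>k n::nat. bipoly P (of_nat (Suc k)) (of_nat n) = 0"
  shows "bipoly P x y = 0"
proof -
  have "poly P [:of_nat n:] = 0" for n
    by (rule poly_eq_0_infinite[of "\<lambda>k. of_nat (Suc k)"])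
      (use assms[of _ n] in \<open>auto simp: inj_def bipoly_def simp del: of_nat_Suc\<close>)
  then have "P = 0"
    by (intro poly_eq_0_infinite[of "\<lambda>n. [:of_nat n:]"]) (auto simp: inj_def)
  then show ?thesis by simp
qed

text \<open>Adding a lowest coefficient multiplies the rest by t and so exchanges the two parts: the
  new even part is a + t^2 B, the new odd part is A.\<close>

lemma bipoly_even_odd:
  "\<exists>A B. \<forall>s t. bipoly R s t = bipoly A s (t\<^sup>2) + t * bipoly B s (t\<^sup>2)"
proof (induction R)
  case 0
  show ?case by (intro exI[of _ 0]) simp
next
  case (pCons a R)
  then obtain A B where "\<And>s t. bipoly R s t = bipoly A s (t\<^sup>2) + t * bipoly B s (t\<^sup>2)" by blast
  then show ?case
    by (intro exI[of _ "pCons a B"] exI[of _ A]) (simp add: algebra_simps power2_eq_square)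
qed

text \<open>In the coordinates \<open>s = y - 2x + 1\<close>, \<open>t = y + 1\<close> the symmetry is \<open>t \<mapsto> -t\<close>, and
  \<open>4x(y - x + 1) = t\<^sup>2 - s\<^sup>2\<close>.\<close>

lemma symmetric_bipoly_factor:
  fixes P :: "'k::field_char_0 poly poly"
  assumes vanish: "\<And>n::nat. bipoly P (of_nat (n + 1)) (of_nat n) = 0"
    and symm: "\<And>k n::nat. bipoly P (of_nat (n + Suc k + 1)) (of_nat n)
      = bipoly P (of_nat (Suc k)) (- of_nat n - 2)"
  obtains B where "\<And>x y. bipoly P x y = x * (y - x + 1) * bipoly B (y - 2 * x + 1) ((y + 1)\<^sup>2)"
proof -
  let ?x = "[:[:0, 1:]:] :: 'k poly poly" and ?y = "[:0, 1:] :: 'k poly poly"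
  \<comment> \<open>R1, R2 and R3 are the sides of the two hypotheses as polynomials; this carries
    the hypotheses from the grid to all arguments.\<close>
  have "\<exists>R. \<forall>x y. bipoly R x y = bipoly P (y + 1) y"
    using bipoly_subst[of P "?y + 1" ?y] by (simp add: one_pCons add.commute)
  then obtain R1 where R1: "\<And>x y. bipoly R1 x y = bipoly P (y + 1) y" by blast
  have v: "bipoly P (y + 1) y = 0" for y
    using bipoly_eq_0_grid[of R1 0 y] vanish by (simp add: R1 add.commute)
  have "\<exists>R. \<forall>x y. bipoly R x y = bipoly P (x + y + 1) y"
    using bipoly_subst[of P "?x + ?y + 1" ?y] by (simp add: one_pCons add_ac)
  then obtain R2 where R2: "\<And>x y. bipoly R2 x y = bipoly P (x + y + 1) y" by blast
  have "\<exists>R. \<forall>x y. bipoly R x y = bipoly P x (- y - 2)"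
    using bipoly_subst[of P ?x "[:[:-2:], [:-1:]:]"] by (simp add: algebra_simps)
  then obtain R3 where R3: "\<And>x y. bipoly R3 x y = bipoly P x (- y - 2)" by blast
  have s: "bipoly P (x + y + 1) y = bipoly P x (- y - 2)" for x y
  proof -
    have "bipoly (R2 - R3) x y = 0"
    proof (rule bipoly_eq_0_grid)
      fix k n :: nat
      show "bipoly (R2 - R3) (of_nat (Suc k)) (of_nat n) = 0"
        using symm[of n k] by (simp add: R2 R3 add_ac)
    qed
    then show ?thesis by (simp add: R2 R3)
  qed
  \<comment> \<open>R is P in the coordinates s and t, inverted as x = (t - s)/2 and y = t -
    1.\<close>
  have "\<exists>R. \<forall>s t. bipoly R s t = bipoly P ((t - s) / 2) (t - 1)"
    using bipoly_subst[of P "[:[:0, -1/2:], [:1/2:]:]" "[:[:-1:], [:1:]:]"]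
    by (simp add: algebra_simps diff_divide_distrib)
  then obtain R where R: "\<And>s t. bipoly R s t = bipoly P ((t - s) / 2) (t - 1)" by blast
  have even: "bipoly R u (- t) = bipoly R u t" for u t
  proof -
    have "(- t - u) / 2 + (t - 1) + 1 = (t - u) / 2" by (simp add: field_simps)
    moreover have "- (t - 1) - 2 = - t - 1" by simp
    ultimately show ?thesis using s[of "(- t - u) / 2" "t - 1"] by (simp only: R)
  qed
  obtain A A' where A: "\<And>u t. bipoly R u t = bipoly A u (t\<^sup>2) + t * bipoly A' u (t\<^sup>2)"
    using bipoly_even_odd[of R] by blast
  have RA: "bipoly R u t = bipoly A u (t\<^sup>2)" for u t
  proof -
    have "2 * (t * bipoly A' u (t\<^sup>2)) = 0" using even[of u t] by (simp add: A)
    then show ?thesis by (simp add: A)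
  qed
  \<comment> \<open>The line s = t is x = 0. The symmetry maps it to the line x = y + 1, on which P
    is known to vanish.\<close>
  have "bipoly A u (u\<^sup>2) = 0" for u
  proof -
    have "bipoly R u u = bipoly P 0 (u - 1)" by (simp add: R)
    also have "\<dots> = 0" using s[of 0 "- u - 1"] v[of "- u - 1"] by simp
    finally show ?thesis by (simp add: RA)
  qed
  \<comment> \<open>A, as a polynomial in T = t^2 over the polynomials in s, has the root s^2, so T
    - s^2 divides it.\<close>
  then have "poly (poly A [:0, 0, 1:]) u = 0" for u by (simp add: bipoly_poly power2_eq_square)
  then have "poly A [:0, 0, 1:] = 0" using poly_all_0_iff_0 by blast
  then obtain B where B: "A = [:- [:0, 0, 1:], 1:] * B" by (auto simp: poly_eq_0_iff_dvd)
  have "bipoly P x y = x * (y - x + 1) * bipoly ([:[:4:]:] * B) (y - 2 * x + 1) ((y + 1)\<^sup>2)" for x y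
  proof -
    have "bipoly P x y = bipoly R (y - 2 * x + 1) (y + 1)" by (simp add: R)
    also have "\<dots> = ((y + 1)\<^sup>2 - (y - 2 * x + 1)\<^sup>2) * bipoly B (y - 2 * x + 1) ((y + 1)\<^sup>2)"
      unfolding RA B bipoly_simps by (simp add: power2_eq_square algebra_simps)
    also have "(y + 1)\<^sup>2 - (y - 2 * x + 1)\<^sup>2 = 4 * (x * (y - x + 1))"
      by (simp add: power2_eq_square algebra_simps)
    finally show ?thesis by (simp only: bipoly_simps) simp
  qed
  then show ?thesis using that by blast
qed

section \<open>Comparison of the two representations\<close>

text \<open>\<open>H + 1\<close> and the Casimir element \<open>4X\<^sup>-X\<^sup>+ + (H + 1)\<^sup>2\<close> act on \<open>b\<^sub>k\<close> by \<open>n - 2k + 1\<close> and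
  \<open>(n + 1)\<^sup>2\<close>.\<close>

lemma diagonal_op_exists:
  fixes B :: "'k::field_char_0 poly poly"
  shows "\<exists>f\<in>carrier freealg. \<forall>n v k. free_op sl2_col f n v k
    = fps_const (bipoly B (of_int n - 2 * of_nat k + 1) ((of_int n + 1)\<^sup>2)) * v k"
proof -
  \<comment> \<open>The diagonal operators that come from the free algebra contain the constants and
    are closed under sums and products. It is therefore enough to produce H + 1 and the Casimir
    element.\<close>
  define D where "D d \<longleftrightarrow> (\<exists>f\<in>carrier freealg. \<forall>n v k. free_op sl2_col f n v k = fps_const (d n k) * v k)"
    for d :: "int \<Rightarrow> nat \<Rightarrow> 'k"
  have const: "D (\<lambda>n k. c)" for c
    unfolding D_def
    by (intro bexI[of _ "fsmult c (fword [])"] allI fsmult_closed fword_closed)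
      (simp add: free_op_smult free_op_fword)
  have add: "D (\<lambda>n k. d n k + d' n k)" if "D d" "D d'" for d d'
  proof -
    from that(1) obtain f where f: "f \<in> carrier freealg"
      "\<forall>n v k. free_op sl2_col f n v k = fps_const (d n k) * v k"
      unfolding D_def by (rule bexE)
    from that(2) obtain f' where f': "f' \<in> carrier freealg"
      "\<forall>n v k. free_op sl2_col f' n v k = fps_const (d' n k) * v k"
      unfolding D_def by (rule bexE)
    show ?thesis unfolding D_def
      by (intro bexI[of _ "f \<oplus>\<^bsub>freealg\<^esub> f'"] allI freealg_add_closed f(1) f'(1))
        (simp only: free_op_add[OF f(1) f'(1)] f(2) f'(2) fps_const_add[symmetric] distrib_right)
  qed
  have mult: "D (\<lambda>n k. d n k * d' n k)" if "D d" "D d'" for d d'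
  proof -
    from that(1) obtain f where f: "f \<in> carrier freealg"
      "\<forall>n v k. free_op sl2_col f n v k = fps_const (d n k) * v k"
      unfolding D_def by (rule bexE)
    from that(2) obtain f' where f': "f' \<in> carrier freealg"
      "\<forall>n v k. free_op sl2_col f' n v k = fps_const (d' n k) * v k"
      unfolding D_def by (rule bexE)
    show ?thesis unfolding D_def
      by (intro bexI[of _ "f \<otimes>\<^bsub>freealg\<^esub> f'"] allI freealg_mult_closed f(1) f'(1))
        (simp only: free_op_mult[OF f(1) f'(1)] f(2) f'(2) fps_const_mult[symmetric] mult.assoc)
  qed
  have H: "D (\<lambda>n k. of_int n - 2 * of_nat k + 1)"
  proof (rule add[OF _ const])
    show "D (\<lambda>n k. of_int n - 2 * of_nat k)" unfolding D_def
      by (rule bexI[of _ "fword [GH]"]) (simp_all add: free_op_fword fword_closed gen_op_def)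
  qed
  have C: "D (\<lambda>n k. (of_int n + 1)\<^sup>2)"
  proof -
    have "D (\<lambda>n k. of_nat k * (of_int n - of_nat k + 1))" unfolding D_def
      by (rule bexI[of _ "fword [GXm, GXp]"])
        (auto simp: free_op_fword fword_closed gen_op_def sl2_col_def)
    from add[OF mult[OF const[of 4] this] mult[OF H H]] show ?thesis
      by (simp add: algebra_simps power2_eq_square)
  qed
  have p: "D (\<lambda>n k. poly a (of_int n - 2 * of_nat k + 1))" for a
  proof (induction a)
    case 0
    show ?case using const[of 0] by simp
  next
    case (pCons c a)
    show ?case using add[OF const[of c] mult[OF H pCons.IH]] by simp
  qed
  have "D (\<lambda>n k. bipoly B (of_int n - 2 * of_nat k + 1) ((of_int n + 1)\<^sup>2))"
  proof (induction B)
    case 0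
    show ?case using const[of 0] by simp
  next
    case (pCons a B)
    show ?case using add[OF p[of a] mult[OF C pCons.IH]] by simp
  qed
  then show ?thesis unfolding D_def .
qed

section \<open>Equality in U(sl2)[[h]] tested on basis vectors\<close>

lemma word_op_sl2_const:
  "\<exists>h. word_op sl2_col w n (basis_vec l :: nat \<Rightarrow> 'k::field_char_0 fps) = (\<lambda>k. fps_const (h k))"
proof (induction w)
  case Nil
  have "(basis_vec l :: nat \<Rightarrow> 'k fps) = (\<lambda>k. fps_const (if k = l then 1 else 0))"
    by (auto simp: basis_vec_def)
  then show ?case unfolding word_op_Nil by (rule exI[of _ "\<lambda>k. if k = l then 1 else 0"])
next
  case (Cons g w)
  then obtain h where h: "word_op sl2_col w n (basis_vec l :: nat \<Rightarrow> 'k fps) = (\<lambda>k. fps_const (h k))" by blast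
  define h' where "h' k = (case g of
      GH \<Rightarrow> (of_int n - 2 * of_nat k) * h k
    | GXm \<Rightarrow> if k = 0 then 0 else h (k - 1)
    | GXp \<Rightarrow> of_nat (Suc k) * (of_int n - of_nat (Suc k) + 1) * h (Suc k))" for k
  have "gen_op sl2_col g n (\<lambda>k. fps_const (h k)) = (\<lambda>k. fps_const (h' k))"
    by (cases g) (auto simp: gen_op_def sl2_col_def h'_def)
  then show ?case unfolding word_op_Cons h by (rule exI[of _ h'])
qed

text \<open>The undeformed action is defined over the ground field, so no h appears in the image of
  a basis vector. The coefficients of a series of operators can therefore be read off separately, as
  in \<open>sl2_series_eq\<close>.\<close>

lemma coset_op_sl2_const:
  "coset_op sl2_col C n (basis_vec l) k = fps_const (fps_nth (coset_op sl2_col C n (basis_vec l) k) 0)"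
proof -
  have "fps_nth (word_op sl2_col w n (basis_vec l :: nat \<Rightarrow> 'a fps) k) m = 0" if "m > 0" for m w
    using word_op_sl2_const[of w n l, where 'k = 'a] that by (elim exE) simp
  then show ?thesis
    by (auto simp: fps_eq_iff coset_op_def free_op_def word_sum_def fps_sum_nth)
qed

text \<open>Comparing constant terms only makes the test usable with an action that agrees with that
  of sl2 merely modulo h.\<close>

lemma sl2_coset_eq:
  assumes C: "C \<in> carrier sl2.Q" "D \<in> carrier sl2.Q"
    and eq: "\<And>n l k. fps_nth (coset_op sl2_col C n (basis_vec l) k) 0
      = fps_nth (coset_op sl2_col D n (basis_vec l) k) 0"
  shows "C = D"
proof -
  obtain f g where f: "f \<in> carrier freealg" "C = sl2.cl f" and g: "g \<in> carrier freealg" "D = sl2.cl g"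
    using C by (auto simp: sl2.carrier_Q)
  have "coset_op sl2_col C n (basis_vec l) k = coset_op sl2_col D n (basis_vec l) k" for n l k
    using eq by (metis coset_op_sl2_const)
  then have "free_op sl2_col (f \<ominus>\<^bsub>freealg\<^esub> g) n (basis_vec l) k = 0" for n l k
    by (simp add: free_op_minus f g sl2.coset_op_cl)
  then have "f \<ominus>\<^bsub>freealg\<^esub> g \<in> I_sl2"
    by (intro sl2_faithful) (simp_all add: f g)
  then show ?thesis using f g by (simp add: sl2.cl_eq_iff freealg_minus)
qed

lemma sl2_series_eq:
  assumes x: "x \<in> carrier sl2.S" "y \<in> carrier sl2.S"
    and eq: "\<And>n l k. series_op sl2_col x n (basis_vec l) k = series_op sl2_col y n (basis_vec l) k"
  shows "x = y"
proof
  fix m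
  have nth: "fps_nth (series_op sl2_col x n (basis_vec l) k) m
      = fps_nth (coset_op sl2_col (x m) n (basis_vec l) k) 0" for x n l k
  proof -
    have "fps_nth (series_op sl2_col x n (basis_vec l) k) m
        = fps_nth (hsum (\<lambda>i. fps_const (fps_nth (coset_op sl2_col (x i) n (basis_vec l) k) 0))) m"
      unfolding series_op_def using coset_op_sl2_const by metis
    then show ?thesis
      using hsum_fps_const[of "Abs_fps (\<lambda>i. fps_nth (coset_op sl2_col (x i) n (basis_vec l) k) 0)"]
      by simp
  qed
  show "x m = y m"
    using x eq by (intro sl2_coset_eq) (simp_all add: series_simps flip: nth)
qed

section \<open>The two algebras have the same image\<close>

context
  fixes \<psi> :: "nat \<Rightarrow> int \<Rightarrow> 'k::field_char_0 fps"
  assumes reg: "regular_colouring \<psi>"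
begin

lemma Xp_in_range:
  "\<exists>y\<in>carrier sl2.S. \<forall>n v k. series_op sl2_col y n v k = gen_op \<psi> GXp n v k"
proof -
  have "\<exists>f\<in>carrier freealg. \<forall>n v k. free_op sl2_col f n v k = fps_const (fps_nth (\<psi> (Suc k) n) m) * v (Suc k)" for m
  proof -
    obtain P :: "'k poly poly" where P: "\<And>k n. k \<ge> 1 \<Longrightarrow> fps_nth (\<psi> k n) m = bipoly P (of_nat k) (of_int n)"
      using reg unfolding regular_colouring_def bipoly_def by blast
    have "bipoly P (of_nat (n + 1)) (of_nat n) = 0" for n
      using P[of "n + 1" "int n"] reg by (simp add: regular_colouring_def colouring_def)
    moreover have "bipoly P (of_nat (n + Suc k + 1)) (of_nat n) = bipoly P (of_nat (Suc k)) (- of_nat n - 2)" for n k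
    proof -
      have "Suc k \<ge> 1" by simp
      then have "\<psi> (n + Suc k + 1) (int n) = \<psi> (Suc k) (- int n - 2)"
        using reg unfolding regular_colouring_def colouring_def by blast
      then show ?thesis using P[of "n + Suc k + 1" "int n"] P[of "Suc k" "- int n - 2"] by simp
    qed
    ultimately obtain B where
      B: "\<And>x y. bipoly P x y = x * (y - x + 1) * bipoly B (y - 2 * x + 1) ((y + 1)\<^sup>2)"
      by (rule symmetric_bipoly_factor) blast
    obtain f where f: "f \<in> carrier freealg" "\<And>n v k. free_op sl2_col f n v k
        = fps_const (bipoly B (of_int n - 2 * of_nat k + 1) ((of_int n + 1)\<^sup>2)) * v k"
      using diagonal_op_exists[of B] by blast
    \<comment> \<open>The diagonal factor stands to the right of X^+, so B is evaluated at the
      source index k + 1, the index at which \<open>\<psi>\<close> is taken.\<close>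
    have "free_op sl2_col (fword [GXp] \<otimes>\<^bsub>freealg\<^esub> f) n v k = fps_const (fps_nth (\<psi> (Suc k) n) m) * v (Suc k)" for n v k
      by (simp add: free_op_mult f fword_closed free_op_fword gen_op_def P B sl2_col_def mult.assoc
          flip: fps_const_mult)
    then show ?thesis using f(1) fword_closed freealg_mult_closed by blast
  qed
  then obtain F where F: "\<And>m. F m \<in> carrier freealg"
    "\<And>m n v k. free_op sl2_col (F m) n v k = fps_const (fps_nth (\<psi> (Suc k) n) m) * v (Suc k)"
    by metis
  have "series_op sl2_col (\<lambda>m. sl2.cl (F m)) n v k = gen_op \<psi> GXp n v k" for n v k
    using hsum_cmult[of "v (Suc k)" "\<lambda>i. fps_const (fps_nth (\<psi> (Suc k) n) i)"]
    by (simp add: series_op_def sl2.coset_op_cl F gen_op_def hsum_fps_const mult.commute)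
  moreover have "(\<lambda>m. sl2.cl (F m)) \<in> carrier sl2.S"
    by (simp add: series_simps sl2.cl_closed F)
  ultimately show ?thesis by blast
qed

lemma word_in_range:
  "\<exists>y\<in>carrier sl2.S. \<forall>n v k. series_op sl2_col y n v k = word_op \<psi> w n v k"
proof (induction w)
  case Nil
  show ?case using sl2.series_op_one by (intro bexI[of _ "\<one>\<^bsub>sl2.S\<^esub>"]) auto
next
  case (Cons g w)
  obtain y where y: "y \<in> carrier sl2.S" "\<And>n v k. series_op sl2_col y n v k = word_op \<psi> w n v k"
    using Cons by blast
  have "\<exists>z\<in>carrier sl2.S. \<forall>n v k. series_op sl2_col z n v k = gen_op \<psi> g n v k"
  proof (cases "g = GXp")
    case False
    then have "series_op sl2_col (const_ser sl2.Q (scl [g])) n v k = gen_op \<psi> g n v k" for n v k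
      by (cases g) (simp_all add: sl2.series_op_const sl2.coset_op_cl fword_closed free_op_fword gen_op_def)
    then show ?thesis using sl2.const_closed[OF scl_closed] by blast
  qed (use Xp_in_range in simp)
  then obtain z where z: "z \<in> carrier sl2.S" "\<And>n v k. series_op sl2_col z n v k = gen_op \<psi> g n v k"
    by blast
  have "series_op sl2_col (z \<otimes>\<^bsub>sl2.S\<^esub> y) n v k = word_op \<psi> (g # w) n v k" for n v k
    using y z by (simp add: sl2.series_op_mult) (metis ext)
  then show ?case using sl2.S.m_closed[OF z(1) y(1)] by blast
qed

lemma free_in_range:
  assumes "f \<in> carrier freealg"
  shows "\<exists>y\<in>carrier sl2.S. \<forall>n v k. series_op sl2_col y n v k = free_op \<psi> f n v k"
  using assms subset_UNIV
proof (induction f rule: freealg_induct)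
  case zero
  show ?case using sl2.series_op_zero
    by (intro bexI[of _ "\<zero>\<^bsub>sl2.S\<^esub>"]) (auto simp: free_op_zero)
next
  case (add f c w)
  obtain y where y: "y \<in> carrier sl2.S" "\<And>n v k. series_op sl2_col y n v k = free_op \<psi> f n v k"
    using add.IH by blast
  obtain z where z: "z \<in> carrier sl2.S" "\<And>n v k. series_op sl2_col z n v k = word_op \<psi> w n v k"
    using word_in_range by blast
  show ?case using y z add.hyps
    by (intro bexI[of _ "y \<oplus>\<^bsub>sl2.S\<^esub> ser_smult sl2.Q sl2.sm (fps_const c) z"])
      (simp_all add: sl2.series_op_add sl2.series_op_smult sl2.ser_smult_closed free_op_add
        free_op_smult free_op_fword fsmult_closed fword_closed)
qed

lemma series_in_range:
  assumes u: "u \<in> carrier Uha"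
  shows "\<exists>y\<in>carrier sl2.S. \<forall>n v k. series_op sl2_col y n v k = series_op \<psi> u n v k"
proof -
  have "\<exists>y\<in>carrier sl2.S. \<forall>n v k. series_op sl2_col y n v k = coset_op \<psi> (u i) n v k" for i
  proof -
    have "u i \<in> carrier Ua.Q" using u by (simp add: Uha_def Ua_def series_simps)
    then obtain f where "f \<in> carrier freealg" "u i = Ua.cl f" by (auto simp: Ua.carrier_Q)
    then show ?thesis using free_in_range[of f] by (simp add: Ua.coset_op_cl)
  qed
  then obtain y where y: "\<And>i. y i \<in> carrier sl2.S"
    "\<And>i n v k. series_op sl2_col (y i) n v k = coset_op \<psi> (u i) n v k" by metis
  have yc: "y i j \<in> carrier sl2.Q" for i j using y(1)[of i] by (simp add: series_simps)
  \<comment> \<open>y i already carries powers of h, so the coefficient of its h^j contributes to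
    degree i + j.\<close>
  define z where "z m = finsum sl2.Q (\<lambda>i. y i (m - i)) {..m}" for m
  have "z \<in> carrier sl2.S" by (auto simp: z_def series_simps yc intro!: sl2.Q.finsum_closed)
  moreover have "series_op sl2_col z n v k = series_op \<psi> u n v k" for n v k
  proof -
    have "series_op sl2_col z n v k = hsum (\<lambda>m. \<Sum>i\<le>m. coset_op sl2_col (y i (m - i)) n v k)"
      by (simp add: series_op_def z_def sl2.coset_op_finsum yc)
    also have "\<dots> = hsum (\<lambda>i. series_op sl2_col (y i) n v k)"
      unfolding series_op_def by (rule hsum_hsum[symmetric])
    also have "\<dots> = series_op \<psi> u n v k" unfolding y(2) by (simp add: series_op_def)
    finally show ?thesis .
  qed
  ultimately show ?thesis by blast
qed

text \<open>This is (C1), propagated through words.\<close>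

lemma word_op_mod_h: "fps_nth (word_op \<psi> w n v k) 0 = fps_nth (word_op sl2_col w n v k) 0"
  using reg by (induction w arbitrary: k)
    (auto simp: gen_op_def sl2_col_def regular_colouring_def colouring_def split: agen.split)

lemma free_op_mod_h: "fps_nth (free_op \<psi> f n v k) 0 = fps_nth (free_op sl2_col f n v k) 0"
  by (simp add: free_op_def word_sum_def fps_sum_nth word_op_mod_h)

text \<open>Modulo h the action of f on V_h is its sl2 action, and faithfulness determines the
  class. Both the approximation in \<open>sl2_in_range_step\<close> and the compatibility of g-bar
  with the structural maps rest on this.\<close>

lemma range_constant_term:
  assumes f: "f \<in> carrier freealg" and y: "y \<in> carrier sl2.S"
    and eq: "\<And>n v k. series_op sl2_col y n v k = free_op \<psi> f n v k"
  shows "y 0 = sl2.cl f"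
proof (rule sl2_coset_eq)
  fix n l k
  have "fps_nth (series_op sl2_col y n (basis_vec l) k) 0 = fps_nth (coset_op sl2_col (y 0) n (basis_vec l) k) 0"
    by (simp add: series_op_def)
  then show "fps_nth (coset_op sl2_col (y 0) n (basis_vec l) k) 0 = fps_nth (coset_op sl2_col (sl2.cl f) n (basis_vec l) k) 0"
    by (simp add: eq sl2.coset_op_cl[OF f] free_op_mod_h)
qed (use f y in \<open>auto simp: sl2.cl_closed series_simps\<close>)

text \<open>f lifts the constant term of x, and y in U(sl2)[[h]] reproduces the deformed action of
  f. As y and x have the same constant term, their difference is divisible by h, and x' is the
  quotient.\<close>

lemma sl2_in_range_step:
  assumes x: "x \<in> carrier sl2.S"
  shows "\<exists>f x'. f \<in> carrier freealg \<and> x' \<in> carrier sl2.S \<and>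
    (\<forall>n v k. series_op sl2_col x n v k = free_op \<psi> f n v k + fps_X * series_op sl2_col x' n v k)"
proof -
  have "x 0 \<in> carrier sl2.Q" using x by (simp add: series_simps)
  then obtain f where f: "f \<in> carrier freealg" "x 0 = sl2.cl f"
    by (auto simp: sl2.carrier_Q)
  obtain y where y: "y \<in> carrier sl2.S" "\<And>n v k. series_op sl2_col y n v k = free_op \<psi> f n v k"
    using free_in_range[OF f(1)] by blast
  have y0: "y 0 = x 0" using range_constant_term[OF f(1) y] f(2) by simp
  have split: "series_op sl2_col z n v k = coset_op sl2_col (z 0) n v k
      + fps_X * series_op sl2_col (\<lambda>m. z (Suc m)) n v k" for z n v k
    unfolding series_op_def by (rule hsum_rec)
  define x' where "x' = (\<lambda>m. x (Suc m)) \<ominus>\<^bsub>sl2.S\<^esub> (\<lambda>m. y (Suc m))"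
  have c: "(\<lambda>m. x (Suc m)) \<in> carrier sl2.S" "(\<lambda>m. y (Suc m)) \<in> carrier sl2.S"
    using x y by (simp_all add: series_simps)
  have "series_op sl2_col x n v k = free_op \<psi> f n v k + fps_X * series_op sl2_col x' n v k" for n v k
    using split[of x n v k] split[of y n v k] y0
    by (simp add: y(2) x'_def sl2.series_op_minus[OF c] right_diff_distrib)
  moreover have "x' \<in> carrier sl2.S" unfolding x'_def using c by simp
  ultimately show ?thesis using f(1) by blast
qed

lemma sl2_in_range:
  assumes x: "x \<in> carrier sl2.S"
  shows "\<exists>u\<in>carrier Uha. \<forall>n v k. series_op \<psi> u n v k = series_op sl2_col x n v k"
proof -
  obtain F N where F: "\<And>x. x \<in> carrier sl2.S \<Longrightarrow> F x \<in> carrier freealg"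
    and N: "\<And>x. x \<in> carrier sl2.S \<Longrightarrow> N x \<in> carrier sl2.S"
    and FN: "\<And>x n v k. x \<in> carrier sl2.S \<Longrightarrow>
      series_op sl2_col x n v k = free_op \<psi> (F x) n v k + fps_X * series_op sl2_col (N x) n v k"
    using sl2_in_range_step by metis
  have Nm: "(N ^^ m) x \<in> carrier sl2.S" for m by (induction m) (simp_all add: x N)
  \<comment> \<open>The remainder after m + 1 steps carries h^(m+1), so coefficient m is already
    final. The induction needs all x, because the tail of the expansion of x is the expansion of
    \<open>N x\<close>.\<close>
  have "fps_nth (hsum (\<lambda>i. free_op \<psi> (F ((N ^^ i) x)) n v k)) m = fps_nth (series_op sl2_col x n v k) m"
    if "x \<in> carrier sl2.S" for x n v k m
    using that
  proof (induction m arbitrary: x)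
    case 0
    then show ?case by (simp add: FN)
  next
    case (Suc m)
    show ?case
      using Suc.IH[OF N[OF Suc.prems]]
      by (subst hsum_rec) (simp add: FN[OF Suc.prems] funpow_swap1)
  qed
  then have "hsum (\<lambda>i. free_op \<psi> (F ((N ^^ i) x)) n v k) = series_op sl2_col x n v k" for n v k
    using x by (intro fps_ext) blast
  then have "series_op \<psi> (\<lambda>i. Ua.cl (F ((N ^^ i) x))) n v k = series_op sl2_col x n v k" for n v k
    by (simp add: series_op_def Ua.coset_op_cl F Nm)
  moreover have "(\<lambda>i. Ua.cl (F ((N ^^ i) x))) \<in> carrier Uha"
    unfolding Uha_def Ua_def series_simps by (intro allI Ua.cl_closed F Nm)
  ultimately show ?thesis by blast
qed

end

section \<open>The trivialization\<close>

interpretation Uha: ring "Uha :: (nat \<Rightarrow> (agen list \<Rightarrow> 'k::field_char_0) set) ring"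
  unfolding Uha_def Ua_def by (rule Ua.S.ring_axioms)

lemma series_op_cmult: "series_op \<psi> u n (\<lambda>k. c * v k) k = c * series_op \<psi> u n v k"
  by (simp add: series_op_def coset_op_def free_op_cmult hsum_cmult)

lemmas series_op_Uha =
  Ua.series_op_add[folded Ua_def, folded Uha_def] Ua.series_op_mult[folded Ua_def, folded Uha_def]
  Ua.series_op_minus[folded Ua_def, folded Uha_def] Ua.series_op_one[folded Ua_def, folded Uha_def]
  Ua.series_op_zero[folded Ua_def, folded Uha_def]

lemma series_op_Uha_smult:
  "u \<in> carrier Uha \<Longrightarrow> series_op \<psi> (ser_smult Ua Ua_sm c u) n v k = c * series_op \<psi> u n v k"
  "u \<in> carrier Uha \<Longrightarrow> ser_smult Ua Ua_sm c u \<in> carrier Uha"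
  unfolding Uha_def Ua_def Ua_sm_def by (rule Ua.series_op_smult Ua.ser_smult_closed; assumption)+

lemma ideal_ann: "ideal (ann \<psi>) Uha"
proof (rule idealI[OF Uha.ring_axioms])
  have neg: "\<ominus>\<^bsub>Uha\<^esub> a = \<zero>\<^bsub>Uha\<^esub> \<ominus>\<^bsub>Uha\<^esub> a" if "a \<in> carrier Uha" for a :: "nat \<Rightarrow> (agen list \<Rightarrow> 'a) set"
    using that by (simp add: a_minus_def)
  show "subgroup (ann \<psi>) (add_monoid Uha)"
  proof (rule Uha.add.subgroupI)
    show "ann \<psi> \<noteq> {}" using series_op_Uha(5)[of \<psi>] Uha.zero_closed ann_iff by blast
    show "ann \<psi> \<subseteq> carrier Uha" by (auto simp: ann_iff)
    show "\<ominus>\<^bsub>Uha\<^esub> a \<in> ann \<psi>" if "a \<in> ann \<psi>" for a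
      using that by (simp add: ann_iff neg series_op_Uha)
    show "a \<oplus>\<^bsub>Uha\<^esub> b \<in> ann \<psi>" if "a \<in> ann \<psi>" "b \<in> ann \<psi>" for a b
      using that by (simp add: ann_iff series_op_Uha)
  qed
  fix a x :: "nat \<Rightarrow> (agen list \<Rightarrow> 'a) set" assume a: "a \<in> ann \<psi>" and x: "x \<in> carrier Uha"
  have "series_op \<psi> a n v = (\<lambda>k. 0)" for n v using a by (auto simp: ann_iff)
  moreover have "series_op \<psi> x n (\<lambda>k. 0) k = 0" for n k
    using series_op_cmult[of \<psi> x n 0 "\<lambda>k. 0" k] by simp
  ultimately show "x \<otimes>\<^bsub>Uha\<^esub> a \<in> ann \<psi>" "a \<otimes>\<^bsub>Uha\<^esub> x \<in> ann \<psi>"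
    using a x by (simp_all add: ann_iff series_op_Uha)
qed

lemma ring_Uhpsi: "ring (Uhpsi \<psi>)"
  unfolding Uhpsi_def by (rule ideal.quotient_is_ring[OF ideal_ann])

text \<open>By construction \<open>U\<^sub>h(\<psi>)\<close> acts faithfully, so its elements are identified with operators.\<close>

definition class_op :: "(nat \<Rightarrow> int \<Rightarrow> 'k::field_char_0 fps) \<Rightarrow> (nat \<Rightarrow> (agen list \<Rightarrow> 'k) set) set \<Rightarrow>
    int \<Rightarrow> (nat \<Rightarrow> 'k fps) \<Rightarrow> nat \<Rightarrow> 'k fps" where
  "class_op \<psi> C = series_op \<psi> (SOME u. u \<in> C)"

abbreviation psi_class :: "(nat \<Rightarrow> int \<Rightarrow> 'k::field_char_0 fps) \<Rightarrow> (nat \<Rightarrow> (agen list \<Rightarrow> 'k) set) \<Rightarrow>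
    (nat \<Rightarrow> (agen list \<Rightarrow> 'k) set) set" where
  "psi_class \<psi> u \<equiv> ann \<psi> +>\<^bsub>Uha\<^esub> u"

lemma carrier_Uhpsi: "C \<in> carrier (Uhpsi \<psi>) \<longleftrightarrow> (\<exists>u\<in>carrier Uha. C = psi_class \<psi> u)"
  by (auto simp: Uhpsi_def FactRing_def A_RCOSETS_def')

lemma some_psi_class:
  assumes u: "u \<in> carrier Uha"
  shows "(SOME x. x \<in> psi_class \<psi> u) \<in> carrier Uha"
    "series_op \<psi> (SOME x. x \<in> psi_class \<psi> u) = series_op \<psi> u"
proof -
  interpret ideal "ann \<psi>" Uha by (rule ideal_ann)
  have "(SOME x. x \<in> psi_class \<psi> u) \<in> psi_class \<psi> u"
    using a_rcos_self[OF u] by (rule someI[of "\<lambda>x. x \<in> psi_class \<psi> u"])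
  then obtain a where a: "a \<in> ann \<psi>" "(SOME x. x \<in> psi_class \<psi> u) = a \<oplus>\<^bsub>Uha\<^esub> u"
    by (auto simp: a_r_coset_def')
  then show "(SOME x. x \<in> psi_class \<psi> u) \<in> carrier Uha" using u Icarr[OF a(1)] by simp
  show "series_op \<psi> (SOME x. x \<in> psi_class \<psi> u) = series_op \<psi> u"
    unfolding a(2) using a(1) u Icarr[OF a(1)] by (intro ext) (simp add: series_op_Uha ann_iff)
qed

lemma class_op_class: "u \<in> carrier Uha \<Longrightarrow> class_op \<psi> (psi_class \<psi> u) = series_op \<psi> u"
  by (simp add: class_op_def some_psi_class)

lemma class_op_inj:
  assumes "C \<in> carrier (Uhpsi \<psi>)" "D \<in> carrier (Uhpsi \<psi>)"
    and eq: "\<And>n v k. class_op \<psi> C n v k = class_op \<psi> D n v k"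
  shows "C = D"
proof -
  obtain u u' where u: "u \<in> carrier Uha" "C = psi_class \<psi> u" and u': "u' \<in> carrier Uha" "D = psi_class \<psi> u'"
    using assms by (auto simp: carrier_Uhpsi)
  have "u \<ominus>\<^bsub>Uha\<^esub> u' \<in> ann \<psi>"
    using eq u u' by (simp add: ann_iff series_op_Uha class_op_class)
  then show ?thesis using Uha.quotient_eq_iff_same_a_r_cos[OF ideal_ann u(1) u'(1)] u u' by simp
qed

lemma psi_class_hom: "psi_class \<psi> \<in> ring_hom Uha (Uhpsi \<psi>)"
  unfolding Uhpsi_def by (rule ideal.rcos_ring_hom[OF ideal_ann])

lemma class_op_add:
  assumes "C \<in> carrier (Uhpsi \<psi>)" "D \<in> carrier (Uhpsi \<psi>)"
  shows "class_op \<psi> (C \<oplus>\<^bsub>Uhpsi \<psi>\<^esub> D) n v k = class_op \<psi> C n v k + class_op \<psi> D n v k"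
proof -
  obtain u u' where u: "u \<in> carrier Uha" "C = psi_class \<psi> u" and u': "u' \<in> carrier Uha" "D = psi_class \<psi> u'"
    using assms by (auto simp: carrier_Uhpsi)
  have "C \<oplus>\<^bsub>Uhpsi \<psi>\<^esub> D = psi_class \<psi> (u \<oplus>\<^bsub>Uha\<^esub> u')"
    using ring_hom_add[OF psi_class_hom u(1) u'(1)] u u' by simp
  then show ?thesis using u u' by (simp add: class_op_class series_op_Uha)
qed

lemma class_op_mult:
  assumes "C \<in> carrier (Uhpsi \<psi>)" "D \<in> carrier (Uhpsi \<psi>)"
  shows "class_op \<psi> (C \<otimes>\<^bsub>Uhpsi \<psi>\<^esub> D) n v k = class_op \<psi> C n (class_op \<psi> D n v) k"
proof -
  obtain u u' where u: "u \<in> carrier Uha" "C = psi_class \<psi> u" and u': "u' \<in> carrier Uha" "D = psi_class \<psi> u'"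
    using assms by (auto simp: carrier_Uhpsi)
  have "C \<otimes>\<^bsub>Uhpsi \<psi>\<^esub> D = psi_class \<psi> (u \<otimes>\<^bsub>Uha\<^esub> u')"
    using ring_hom_mult[OF psi_class_hom u(1) u'(1)] u u' by simp
  then show ?thesis using u u' by (simp add: class_op_class series_op_Uha)
qed

lemma class_op_one: "class_op \<psi> \<one>\<^bsub>Uhpsi \<psi>\<^esub> n v k = v k"
  unfolding ring_hom_one[OF psi_class_hom, symmetric] class_op_class[OF Uha.one_closed]
  by (rule series_op_Uha)

lemma class_op_minus:
  assumes "C \<in> carrier (Uhpsi \<psi>)" "D \<in> carrier (Uhpsi \<psi>)"
  shows "class_op \<psi> (C \<ominus>\<^bsub>Uhpsi \<psi>\<^esub> D) n v k = class_op \<psi> C n v k - class_op \<psi> D n v k"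
proof -
  interpret ring "Uhpsi \<psi>" by (rule ring_Uhpsi)
  have "C \<ominus>\<^bsub>Uhpsi \<psi>\<^esub> D \<oplus>\<^bsub>Uhpsi \<psi>\<^esub> D = C" using assms by (simp add: a_minus_def a_assoc l_neg)
  then show ?thesis using class_op_add[of "C \<ominus>\<^bsub>Uhpsi \<psi>\<^esub> D" \<psi> D n v k] assms by simp
qed

lemma class_op_cmult: "class_op \<psi> C n (\<lambda>k. c * v k) k = c * class_op \<psi> C n v k"
  by (simp add: class_op_def series_op_cmult)

lemma class_op_smult:
  assumes "C \<in> carrier (Uhpsi \<psi>)"
  shows "Uhpsi_sm \<psi> c C \<in> carrier (Uhpsi \<psi>)" "class_op \<psi> (Uhpsi_sm \<psi> c C) n v k = c * class_op \<psi> C n v k"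
proof -
  obtain u where u: "u \<in> carrier Uha" "C = psi_class \<psi> u" using assms by (auto simp: carrier_Uhpsi)
  have e: "Uhpsi_sm \<psi> c C = psi_class \<psi> (ser_smult Ua Ua_sm c (SOME x. x \<in> C))"
    by (simp add: Uhpsi_sm_def qsmult_def)
  have s: "(SOME x. x \<in> C) \<in> carrier Uha" using some_psi_class[OF u(1)] u(2) by simp
  show "Uhpsi_sm \<psi> c C \<in> carrier (Uhpsi \<psi>)"
    unfolding e carrier_Uhpsi using series_op_Uha_smult(2)[OF s] by blast
  show "class_op \<psi> (Uhpsi_sm \<psi> c C) n v k = c * class_op \<psi> C n v k"
    unfolding e class_op_class[OF series_op_Uha_smult(2)[OF s]] series_op_Uha_smult(1)[OF s]
    by (simp add: class_op_def)
qed

text \<open>By faithfulness, membership means that the operator is h times an operator that itself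
  comes from U_h(psi).\<close>

lemma hU_iff:
  "C \<in> hU \<psi> \<longleftrightarrow> C \<in> carrier (Uhpsi \<psi>) \<and>
    (\<exists>D\<in>carrier (Uhpsi \<psi>). \<forall>n v k. class_op \<psi> C n v k = fps_X * class_op \<psi> D n v k)"
proof
  assume "C \<in> hU \<psi>"
  then show "C \<in> carrier (Uhpsi \<psi>) \<and> (\<exists>D\<in>carrier (Uhpsi \<psi>). \<forall>n v k. class_op \<psi> C n v k = fps_X * class_op \<psi> D n v k)"
    unfolding hU_def using class_op_smult by blast
next
  assume "C \<in> carrier (Uhpsi \<psi>) \<and> (\<exists>D\<in>carrier (Uhpsi \<psi>). \<forall>n v k. class_op \<psi> C n v k = fps_X * class_op \<psi> D n v k)"
  then obtain D where D: "C \<in> carrier (Uhpsi \<psi>)" "D \<in> carrier (Uhpsi \<psi>)"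
    "\<And>n v k. class_op \<psi> C n v k = fps_X * class_op \<psi> D n v k" by blast
  then have "C = Uhpsi_sm \<psi> fps_X D"
    by (intro class_op_inj[of C \<psi>]) (simp_all add: class_op_smult)
  then show "C \<in> hU \<psi>" unfolding hU_def using D(2) by blast
qed

lemma ideal_hU: "ideal (hU \<psi>) (Uhpsi \<psi>)"
proof (rule idealI[OF ring_Uhpsi])
  interpret ring "Uhpsi \<psi>" by (rule ring_Uhpsi)
  have neg: "\<ominus>\<^bsub>Uhpsi \<psi>\<^esub> a = \<zero>\<^bsub>Uhpsi \<psi>\<^esub> \<ominus>\<^bsub>Uhpsi \<psi>\<^esub> a" if "a \<in> carrier (Uhpsi \<psi>)" for a
    using that by (simp add: a_minus_def)
  have zero: "class_op \<psi> \<zero>\<^bsub>Uhpsi \<psi>\<^esub> n v k = 0" for n v k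
    using class_op_add[of "\<zero>\<^bsub>Uhpsi \<psi>\<^esub>" \<psi> "\<zero>\<^bsub>Uhpsi \<psi>\<^esub>" n v k] by simp
  show "subgroup (hU \<psi>) (add_monoid (Uhpsi \<psi>))"
  proof (rule add.subgroupI)
    have "\<zero>\<^bsub>Uhpsi \<psi>\<^esub> \<in> hU \<psi>" unfolding hU_iff using zero by (intro conjI bexI[of _ "\<zero>\<^bsub>Uhpsi \<psi>\<^esub>"]) auto
    then show "hU \<psi> \<noteq> {}" by blast
    show "hU \<psi> \<subseteq> carrier (Uhpsi \<psi>)" by (auto simp: hU_iff)
  next
    fix a assume "a \<in> hU \<psi>"
    then obtain d where a: "a \<in> carrier (Uhpsi \<psi>)" and d: "d \<in> carrier (Uhpsi \<psi>)"
      "\<And>n v k. class_op \<psi> a n v k = fps_X * class_op \<psi> d n v k" unfolding hU_iff by blast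
    then show "\<ominus>\<^bsub>Uhpsi \<psi>\<^esub> a \<in> hU \<psi>"
      unfolding hU_iff by (intro conjI bexI[of _ "\<ominus>\<^bsub>Uhpsi \<psi>\<^esub> d"]) (simp_all add: neg class_op_minus zero)
    fix b assume "b \<in> hU \<psi>"
    then obtain e where b: "b \<in> carrier (Uhpsi \<psi>)" and e: "e \<in> carrier (Uhpsi \<psi>)"
      "\<And>n v k. class_op \<psi> b n v k = fps_X * class_op \<psi> e n v k" unfolding hU_iff by blast
    show "a \<oplus>\<^bsub>Uhpsi \<psi>\<^esub> b \<in> hU \<psi>"
      unfolding hU_iff using a b d e
      by (intro conjI bexI[of _ "d \<oplus>\<^bsub>Uhpsi \<psi>\<^esub> e"]) (simp_all add: class_op_add ring_distribs)
  qed
  fix a x assume "a \<in> hU \<psi>" and x: "x \<in> carrier (Uhpsi \<psi>)"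
  then obtain d where a: "a \<in> carrier (Uhpsi \<psi>)" and d: "d \<in> carrier (Uhpsi \<psi>)"
    "\<And>n v k. class_op \<psi> a n v k = fps_X * class_op \<psi> d n v k" unfolding hU_iff by blast
  have ad: "class_op \<psi> a n v = (\<lambda>k. fps_X * class_op \<psi> d n v k)" for n v using d(2) by auto
  show "x \<otimes>\<^bsub>Uhpsi \<psi>\<^esub> a \<in> hU \<psi>" unfolding hU_iff using a d(1) x
    by (intro conjI bexI[of _ "x \<otimes>\<^bsub>Uhpsi \<psi>\<^esub> d"]; simp add: class_op_mult class_op_cmult ad)
  show "a \<otimes>\<^bsub>Uhpsi \<psi>\<^esub> x \<in> hU \<psi>" unfolding hU_iff using a d(1) x
    by (intro conjI bexI[of _ "d \<otimes>\<^bsub>Uhpsi \<psi>\<^esub> x"]; simp add: class_op_mult ad)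
qed

text \<open>The two relations force \<open>P b\<^sub>0 = 0\<close> for weight reasons and then determine \<open>P b\<^sub>l\<close> inductively.\<close>

lemma raising_op_unique:
  fixes P :: "(nat \<Rightarrow> 'k::field_char_0 fps) \<Rightarrow> nat \<Rightarrow> 'k fps"
  assumes lin: "\<And>c v k. P (\<lambda>k. c * v k) k = c * P v k"
    and H: "\<And>v k. P (gen_op sl2_col GH n v) k = gen_op sl2_col GH n (P v) k - fps_const 2 * P v k"
    and Xm: "\<And>v k. P (gen_op sl2_col GXm n v) k = gen_op sl2_col GXm n (P v) k + gen_op sl2_col GH n v k"
  shows "P (basis_vec l) = gen_op sl2_col GXp n (basis_vec l)"
proof (induction l)
  case 0
  show ?case
  proof
    fix k
    \<comment> \<open>b_0 has weight n, so P b_0 would have weight n + 2. Its component at b_k has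
      weight n - 2k, and the difference 2k + 2 is invertible in characteristic zero.\<close>
    have "gen_op sl2_col GH n (basis_vec 0) = (\<lambda>k. fps_const (of_int n) * basis_vec 0 k :: 'k fps)"
      by (auto simp: gen_op_def basis_vec_def)
    then have "fps_const (of_int n) * P (basis_vec 0) k
        = fps_const (of_int n - 2 * of_nat k) * P (basis_vec 0) k - fps_const 2 * P (basis_vec 0) k"
      using H[of "basis_vec 0" k] lin[of "fps_const (of_int n)" "basis_vec 0" k] by (simp add: gen_op_def)
    then have "fps_const (of_int n - (of_int n - 2 * of_nat k - 2)) * P (basis_vec 0) k = 0"
      unfolding fps_const_sub[symmetric] left_diff_distrib by (simp only: diff_self)
    moreover have "of_int n - (of_int n - 2 * of_nat k - 2) = (of_nat (2 * k + 2) :: 'k)" by simp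
    moreover have "(of_nat (2 * k + 2) :: 'k) \<noteq> 0" unfolding of_nat_eq_0_iff by simp
    ultimately have "P (basis_vec 0) k = 0" by (simp only: mult_eq_0_iff fps_const_eq_0_iff) auto
    then show "P (basis_vec 0) k = gen_op sl2_col GXp n (basis_vec 0) k"
      by (simp add: gen_op_def basis_vec_def)
  qed
next
  case (Suc l)
  have b: "basis_vec (Suc l) = gen_op sl2_col GXm n (basis_vec l :: nat \<Rightarrow> 'k fps)"
    by (rule ext) (auto simp: gen_op_def basis_vec_def)
  show ?case
  proof
    fix k
    have "P (basis_vec (Suc l)) k = word_op sl2_col [GXm, GXp] n (basis_vec l) k + word_op sl2_col [GH] n (basis_vec l) k"
      unfolding b Xm Suc by simp
    also have "\<dots> = word_op sl2_col [GXp, GXm] n (basis_vec l) k"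
      using free_op_rel_pm[of n "basis_vec l :: nat \<Rightarrow> 'k fps" k] unfolding rel_eq
      by (simp add: free_op_minus fword_closed free_op_fword algebra_simps)
    finally show "P (basis_vec (Suc l)) k = gen_op sl2_col GXp n (basis_vec (Suc l)) k"
      by (simp add: b)
  qed
qed

lemma hU_coset_eqI:
  assumes "C \<in> carrier (Uhpsi \<psi>)" "D \<in> carrier (Uhpsi \<psi>)" "E \<in> carrier (Uhpsi \<psi>)"
    and "\<And>n v k. class_op \<psi> C n v k = class_op \<psi> D n v k + fps_X * class_op \<psi> E n v k"
  shows "hU \<psi> +>\<^bsub>Uhpsi \<psi>\<^esub> C = hU \<psi> +>\<^bsub>Uhpsi \<psi>\<^esub> D"
proof -
  interpret ring "Uhpsi \<psi>" by (rule ring_Uhpsi)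
  have "C \<ominus>\<^bsub>Uhpsi \<psi>\<^esub> D \<in> hU \<psi>"
    unfolding hU_iff using assms by (intro conjI bexI[of _ E]) (simp_all add: class_op_minus)
  then show ?thesis using quotient_eq_iff_same_a_r_cos[OF ideal_hU assms(1,2)] by simp
qed

lemma Usl2_eqs: "Usl2 = sl2.Q" "Usl2h = sl2.S" "Usl2_sm = sl2.sm"
  "Usl2h_sm = ser_smult sl2.Q sl2.sm" "Usl2h_gen g = const_ser sl2.Q (scl [g])"
  by (simp_all add: Usl2_def Usl2h_def Usl2_sm_def Usl2h_sm_def Usl2h_gen_def Usl2_gen_def)

lemma class_op_gen:
  fixes \<psi> :: "nat \<Rightarrow> int \<Rightarrow> 'k::field_char_0 fps"
  shows "Uhpsi_gen \<psi> g \<in> carrier (Uhpsi \<psi>)" "class_op \<psi> (Uhpsi_gen \<psi> g) n v k = gen_op \<psi> g n v k"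
proof -
  have c: "const_ser Ua (Ua_gen g) \<in> carrier (Uha :: (nat \<Rightarrow> (agen list \<Rightarrow> 'k) set) ring)"
    unfolding Uha_def Ua_def Ua_gen_def by (intro Ua.const_closed Ua.cl_closed fword_closed)
  then show "Uhpsi_gen \<psi> g \<in> carrier (Uhpsi \<psi>)" by (auto simp: Uhpsi_gen_def carrier_Uhpsi)
  show "class_op \<psi> (Uhpsi_gen \<psi> g) n v k = gen_op \<psi> g n v k"
    unfolding Uhpsi_gen_def class_op_class[OF c] unfolding Ua_def Ua_gen_def
    by (simp add: Ua.series_op_const Ua.coset_op_cl fword_closed free_op_fword)
qed

text \<open>Pulling the action of U_h(psi) back along g gives an action of U(sl2)[[h]] on the same
  space. H and X^- act in the standard way, the relations force X^+ to do so too, and the rest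
  follows by multiplicativity and linearity. Uniqueness then comes from faithfulness of
  U_h(psi).\<close>

lemma trivialization_determined:
  fixes \<psi> :: "nat \<Rightarrow> int \<Rightarrow> 'k::field_char_0 fps"
  assumes reg: "regular_colouring \<psi>" and g: "b_trivialization \<psi> g" and x: "x \<in> carrier sl2.S"
  shows "class_op \<psi> (g x) n v k = series_op sl2_col x n v k"
proof -
  define T where "T x = class_op \<psi> (g x)" for x
  have hom: "g \<in> ring_hom sl2.S (Uhpsi \<psi>)" and sm: "\<And>c x. x \<in> carrier sl2.S \<Longrightarrow>
      g (ser_smult sl2.Q sl2.sm c x) = Uhpsi_sm \<psi> c (g x)"
    and gens: "g (const_ser sl2.Q (scl [GH])) = Uhpsi_gen \<psi> GH" "g (const_ser sl2.Q (scl [GXm])) = Uhpsi_gen \<psi> GXm"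
    using g unfolding b_trivialization_def ring_iso_def Usl2_eqs by blast+
  note gc = ring_hom_closed[OF hom]
  have T_mult: "T (x \<otimes>\<^bsub>sl2.S\<^esub> y) n v k = T x n (T y n v) k"
    and T_add: "T (x \<oplus>\<^bsub>sl2.S\<^esub> y) n v k = T x n v k + T y n v k"
    if "x \<in> carrier sl2.S" "y \<in> carrier sl2.S" for x y n v k
    using that by (simp_all add: T_def ring_hom_mult[OF hom] ring_hom_add[OF hom] class_op_mult class_op_add gc)
  have T_sm: "T (ser_smult sl2.Q sl2.sm c x) n v k = c * T x n v k" if "x \<in> carrier sl2.S" for c x n v k
    using that by (simp add: T_def sm class_op_smult gc)
  have T_one: "T \<one>\<^bsub>sl2.S\<^esub> n v k = v k" for n v k
    by (simp add: T_def ring_hom_one[OF hom] class_op_one)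
  have T_cmult: "T x n (\<lambda>k. c * v k) k = c * T x n v k" for x n c v k
    by (simp add: T_def class_op_cmult)
  let ?c = "\<lambda>w. const_ser sl2.Q (scl w :: (agen list \<Rightarrow> 'k) set)"
  have cc: "?c w \<in> carrier sl2.S" for w by (rule sl2.const_closed[OF scl_closed])
  have c_Cons: "?c (a # w) = ?c [a] \<otimes>\<^bsub>sl2.S\<^esub> ?c w" for a w
    by (subst scl_Cons) (rule sl2.const_ser_mult[OF scl_closed scl_closed])
  have T_H: "T (?c [GH]) n v k = gen_op sl2_col GH n v k"
    and T_Xm: "T (?c [GXm]) n v k = gen_op sl2_col GXm n v k" for n v k
    by (simp_all add: T_def gens class_op_gen) (simp_all add: gen_op_def)
  have T2: "T (?c [a, b]) n v k = T (?c [a]) n (T (?c [b]) n v) k" for a b n v k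
    by (subst c_Cons) (rule T_mult[OF cc cc])
  have T_H': "T (?c [GH]) n v = gen_op sl2_col GH n v"
    and T_Xm': "T (?c [GXm]) n v = gen_op sl2_col GXm n v" for n v
    by (auto simp: T_H T_Xm)
  have T_Xp: "T (?c [GXp]) n v k = gen_op sl2_col GXp n v k" for n v k
  proof -
    have "T (?c [GXp]) n (basis_vec l) = gen_op sl2_col GXp n (basis_vec l)" for n l
    proof (rule raising_op_unique)
      fix v k
      have "?c [GXp, GH] = ?c [GH, GXp] \<oplus>\<^bsub>sl2.S\<^esub> ser_smult sl2.Q sl2.sm (fps_const (-2)) (?c [GXp])"
        by (simp add: scl_rel(1) sl2.const_ser_add scl_closed sl2.sm_closed sl2.ser_smult_const)
      then have "T (?c [GXp, GH]) n v k = T (?c [GH, GXp]) n v k + fps_const (-2) * T (?c [GXp]) n v k"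
        using cc by (simp add: T_add T_sm sl2.ser_smult_closed)
      then show "T (?c [GXp]) n (gen_op sl2_col GH n v) k
          = gen_op sl2_col GH n (T (?c [GXp]) n v) k - fps_const 2 * T (?c [GXp]) n v k"
        by (simp add: T2 T_H' fps_const_neg[symmetric] del: fps_const_neg)
      have "?c [GXp, GXm] = ?c [GXm, GXp] \<oplus>\<^bsub>sl2.S\<^esub> ?c [GH]"
        by (simp add: scl_rel(3) sl2.const_ser_add scl_closed)
      then have "T (?c [GXp, GXm]) n v k = T (?c [GXm, GXp]) n v k + T (?c [GH]) n v k"
        using cc by (simp add: T_add)
      then show "T (?c [GXp]) n (gen_op sl2_col GXm n v) k
          = gen_op sl2_col GXm n (T (?c [GXp]) n v) k + gen_op sl2_col GH n v k"
        by (simp add: T2 T_H' T_Xm')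
    qed (rule T_cmult)
    moreover have "g (?c [GXp]) \<in> carrier (Uhpsi \<psi>)" by (rule gc[OF cc])
    \<comment> \<open>\<open>raising_op_unique\<close> speaks only of basis vectors. To reach all
      vectors, the operator of g(X^+) is realized by some z in U(sl2)[[h]], and faithfulness on
      basis vectors gives z = X^+.\<close>
    then obtain u where u: "u \<in> carrier Uha" "g (?c [GXp]) = psi_class \<psi> u" by (auto simp: carrier_Uhpsi)
    then obtain z where z: "z \<in> carrier sl2.S" "\<And>n v k. series_op sl2_col z n v k = T (?c [GXp]) n v k"
      using series_in_range[OF reg u(1)] by (auto simp: T_def class_op_class)
    ultimately have "z = ?c [GXp]"
      by (intro sl2_series_eq cc)
        (simp_all add: sl2.series_op_const sl2.coset_op_cl fword_closed free_op_fword)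
    then show ?thesis using z(2)[of n v k]
      by (simp add: sl2.series_op_const sl2.coset_op_cl fword_closed free_op_fword)
  qed
  have T_gen: "T (?c [a]) n v k = gen_op sl2_col a n v k" for a n v k
    by (cases a) (simp_all add: T_H T_Xm T_Xp)
  have T_word: "T (?c w) n v k = word_op sl2_col w n v k" for w n v k
  proof (induction w arbitrary: k)
    case Nil
    have "?c [] = \<one>\<^bsub>sl2.S\<^esub>" by (simp add: sl2.cl_one[symmetric] sl2.const_ser_one)
    then show ?case by (simp add: T_one)
  next
    case (Cons a w)
    have "T (?c w) n v = word_op sl2_col w n v" using Cons by auto
    then show ?case by (subst c_Cons) (simp add: T_mult[OF cc cc] T_gen)
  qed
  have T_free: "T (const_ser sl2.Q (sl2.cl f)) n v k = free_op sl2_col f n v k"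
    if "f \<in> carrier freealg" for f n v k
    using that subset_UNIV
  proof (induction f rule: freealg_induct)
    case zero
    have "const_ser sl2.Q (sl2.cl (\<lambda>w. 0)) = (\<zero>\<^bsub>sl2.S\<^esub> :: nat \<Rightarrow> (agen list \<Rightarrow> 'k) set)"
      by (simp add: sl2.cl_zero[symmetric] const_ser_def series_simps)
    moreover have "T \<zero>\<^bsub>sl2.S\<^esub> n v k = 0"
      using T_add[of "\<zero>\<^bsub>sl2.S\<^esub>" "\<zero>\<^bsub>sl2.S\<^esub>" n v k] by simp
    ultimately show ?case by (simp add: free_op_zero)
  next
    case (add f c w)
    have "const_ser sl2.Q (sl2.cl (f \<oplus>\<^bsub>freealg\<^esub> fsmult c (fword w)))
        = const_ser sl2.Q (sl2.cl f) \<oplus>\<^bsub>sl2.S\<^esub> ser_smult sl2.Q sl2.sm (fps_const c) (?c w)"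
      using add.hyps by (simp add: sl2.cl_add[symmetric] sl2.sm_cl[symmetric] fsmult_closed fword_closed
          sl2.const_ser_add sl2.cl_closed sl2.sm_closed sl2.ser_smult_const)
    then show ?case using add cc
      by (simp add: T_add T_sm T_word sl2.const_closed sl2.cl_closed sl2.ser_smult_closed free_op_add
          free_op_smult free_op_fword fsmult_closed fword_closed)
  qed
  \<comment> \<open>h-adic continuity of g is not part of the definition. It follows from linearity
    over power series: x is its constant term plus h x', so coefficient m for x reduces to
    coefficient m - 1 for x'.\<close>
  have "fps_nth (T x n v k) m = fps_nth (series_op sl2_col x n v k) m"
    if "x \<in> carrier sl2.S" for x m
    using that
  proof (induction m arbitrary: x rule: less_induct)
    case (less m)
    define x' where "x' = (\<lambda>i. x (Suc i))"
    have x': "x' \<in> carrier sl2.S" using less.prems by (simp add: x'_def series_simps)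
    have "x 0 \<in> carrier sl2.Q" using less.prems by (simp add: series_simps)
    then obtain f where f: "f \<in> carrier freealg" "x 0 = sl2.cl f" by (auto simp: sl2.carrier_Q)
    have "T x n v k = free_op sl2_col f n v k + fps_X * T x' n v k"
      by (subst sl2.series_split[OF less.prems])
        (simp add: T_add T_sm T_free f x' sl2.const_closed sl2.cl_closed sl2.ser_smult_closed flip: x'_def)
    moreover have "series_op sl2_col x n v k = free_op sl2_col f n v k + fps_X * series_op sl2_col x' n v k"
      unfolding series_op_def by (subst hsum_rec) (simp add: f sl2.coset_op_cl x'_def)
    ultimately show ?case using less.IH[OF _ x'] by (cases m) simp_all
  qed
  then show ?thesis using x unfolding T_def by (intro fps_ext) blast
qed

text \<open>g x is the class that acts as x does; it exists by \<open>sl2_in_range\<close> and is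
  unique by faithfulness. Every algebraic property of g is then an identity between
  operators.\<close>

lemma trivialization_exists:
  fixes \<psi> :: "nat \<Rightarrow> int \<Rightarrow> 'k::field_char_0 fps"
  assumes reg: "regular_colouring \<psi>"
  shows "\<exists>g. b_trivialization \<psi> g"
proof -
  have "\<exists>C\<in>carrier (Uhpsi \<psi>). \<forall>n v k. class_op \<psi> C n v k = series_op sl2_col x n v k"
    if "x \<in> carrier sl2.S" for x
    using sl2_in_range[OF reg that] by (metis carrier_Uhpsi class_op_class)
  then obtain g where gc: "\<And>x. x \<in> carrier sl2.S \<Longrightarrow> g x \<in> carrier (Uhpsi \<psi>)"
    and g: "\<And>x n v k. x \<in> carrier sl2.S \<Longrightarrow> class_op \<psi> (g x) n v k = series_op sl2_col x n v k"
    by metis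
  have g': "class_op \<psi> (g x) n v = series_op sl2_col x n v" if "x \<in> carrier sl2.S" for x n v
    using g[OF that] by auto
  have surj: "\<exists>x\<in>carrier sl2.S. g x = C" if C: "C \<in> carrier (Uhpsi \<psi>)" for C
  proof -
    obtain u where u: "u \<in> carrier Uha" "C = psi_class \<psi> u" using C by (auto simp: carrier_Uhpsi)
    obtain x where x: "x \<in> carrier sl2.S" "\<And>n v k. series_op sl2_col x n v k = series_op \<psi> u n v k"
      using series_in_range[OF reg u(1)] by blast
    have "g x = C" by (rule class_op_inj[OF gc[OF x(1)] C]) (simp add: g x u class_op_class)
    then show ?thesis using x(1) by blast
  qed
  interpret U: ring "Uhpsi \<psi>" by (rule ring_Uhpsi)
  have hom: "g \<in> ring_hom sl2.S (Uhpsi \<psi>)"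
  proof (rule ring_hom_memI)
    show "g \<one>\<^bsub>sl2.S\<^esub> = \<one>\<^bsub>Uhpsi \<psi>\<^esub>"
      by (rule class_op_inj[of _ \<psi>]) (simp_all add: gc g class_op_one sl2.series_op_one)
    fix x y :: "nat \<Rightarrow> (agen list \<Rightarrow> 'k) set" assume xy: "x \<in> carrier sl2.S" "y \<in> carrier sl2.S"
    show "g (x \<otimes>\<^bsub>sl2.S\<^esub> y) = g x \<otimes>\<^bsub>Uhpsi \<psi>\<^esub> g y"
      using xy by (intro class_op_inj[of _ \<psi>]) (simp_all add: gc g g' class_op_mult sl2.series_op_mult)
    show "g (x \<oplus>\<^bsub>sl2.S\<^esub> y) = g x \<oplus>\<^bsub>Uhpsi \<psi>\<^esub> g y"
      using xy by (intro class_op_inj[of _ \<psi>]) (simp_all add: gc g class_op_add sl2.series_op_add)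
  qed (rule gc)
  have inj: "inj_on g (carrier sl2.S)"
  proof (rule inj_onI)
    fix x y :: "nat \<Rightarrow> (agen list \<Rightarrow> 'k) set" assume "x \<in> carrier sl2.S" "y \<in> carrier sl2.S" "g x = g y"
    then show "x = y" by (intro sl2_series_eq) (simp_all flip: g)
  qed
  have iso: "g \<in> ring_iso sl2.S (Uhpsi \<psi>)"
  proof -
    have "g ` carrier sl2.S = carrier (Uhpsi \<psi>)" using surj gc by blast
    then show ?thesis using hom inj by (simp add: ring_iso_def bij_betw_def)
  qed
  have smult: "g (ser_smult sl2.Q sl2.sm c x) = Uhpsi_sm \<psi> c (g x)" if "x \<in> carrier sl2.S" for c x
    using that by (intro class_op_inj[of _ \<psi>])
      (simp_all add: gc g class_op_smult sl2.ser_smult_closed sl2.series_op_smult)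
  \<comment> \<open>H and X^- act independently of the colouring. The class g(X^+) agrees with X^+
    in general only modulo h.\<close>
  have gen: "g (const_ser sl2.Q (scl [a])) = Uhpsi_gen \<psi> a" if "a \<noteq> GXp" for a
  proof (rule class_op_inj)
    show "class_op \<psi> (g (const_ser sl2.Q (scl [a]))) n v k = class_op \<psi> (Uhpsi_gen \<psi> a) n v k" for n v k
      unfolding g[OF sl2.const_closed[OF scl_closed]] sl2.series_op_const sl2.coset_op_cl[OF fword_closed]
        free_op_fword class_op_gen
      using that by (cases a) (simp_all add: gen_op_def)
  qed (rule gc[OF sl2.const_closed[OF scl_closed]], rule class_op_gen)
  let ?p = "\<lambda>C. hU \<psi> +>\<^bsub>Uhpsi \<psi>\<^esub> C"
  have bar: "gbar \<psi> g u = ?p (g (const_ser sl2.Q u))" for u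
    by (simp add: gbar_def Usl2_eqs)
  have barhom: "gbar \<psi> g \<in> ring_hom sl2.Q (Uhpsi_bar \<psi>)"
  proof -
    have "const_ser sl2.Q \<in> ring_hom (sl2.Q :: (agen list \<Rightarrow> 'k) set ring) sl2.S"
      by (rule ring_hom_memI)
        (simp_all add: sl2.const_closed sl2.const_ser_mult sl2.const_ser_add sl2.const_ser_one)
    from ring_hom_trans[OF ring_hom_trans[OF this hom] ideal.rcos_ring_hom[OF ideal_hU]]
    show ?thesis unfolding Uhpsi_bar_def by (simp add: comp_def bar[abs_def] gbar_def[abs_def] Usl2_eqs)
  qed
  have barinj: "inj_on (gbar \<psi> g) (carrier sl2.Q)"
  proof (rule inj_onI)
    fix u u' :: "(agen list \<Rightarrow> 'k) set" assume u: "u \<in> carrier sl2.Q" "u' \<in> carrier sl2.Q" and eq: "gbar \<psi> g u = gbar \<psi> g u'"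
    note c = gc[OF sl2.const_closed[OF u(1)]] gc[OF sl2.const_closed[OF u(2)]]
    have "g (const_ser sl2.Q u) \<ominus>\<^bsub>Uhpsi \<psi>\<^esub> g (const_ser sl2.Q u') \<in> hU \<psi>"
      using eq U.quotient_eq_iff_same_a_r_cos[OF ideal_hU c] by (simp add: bar)
    \<comment> \<open>The two constants differ by h times an operator, so their actions have equal
      constant terms, which is what \<open>sl2_coset_eq\<close> asks for.\<close>
    then obtain D where D: "\<And>n v k. coset_op sl2_col u n v k - coset_op sl2_col u' n v k = fps_X * class_op \<psi> D n v k"
      unfolding hU_iff using u by (auto simp: class_op_minus c g sl2.const_closed sl2.series_op_const)
    show "u = u'"
    proof (rule sl2_coset_eq[OF u])
      fix n l k
      show "fps_nth (coset_op sl2_col u n (basis_vec l) k) 0 = fps_nth (coset_op sl2_col u' n (basis_vec l) k) 0"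
        using arg_cong[OF D[of n "basis_vec l" k], of "\<lambda>F. fps_nth F 0"] by simp
    qed
  qed
  have barsurj: "\<exists>u\<in>carrier sl2.Q. gbar \<psi> g u = B" if B: "B \<in> carrier (Uhpsi_bar \<psi>)" for B
  proof -
    obtain C where C: "C \<in> carrier (Uhpsi \<psi>)" "B = ?p C"
      using B by (auto simp: Uhpsi_bar_def FactRing_def A_RCOSETS_def')
    obtain x where x: "x \<in> carrier sl2.S" "g x = C" using surj[OF C(1)] by blast
    have x0: "x 0 \<in> carrier sl2.Q" and x': "(\<lambda>m. x (Suc m)) \<in> carrier sl2.S"
      using x(1) by (simp_all add: series_simps)
    have "?p (g x) = ?p (g (const_ser sl2.Q (x 0)))"
    proof (rule hU_coset_eqI)
      show "class_op \<psi> (g x) n v k = class_op \<psi> (g (const_ser sl2.Q (x 0))) n v k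
          + fps_X * class_op \<psi> (g (\<lambda>m. x (Suc m))) n v k" for n v k
        unfolding g[OF x(1)] g[OF x'] g[OF sl2.const_closed[OF x0]] sl2.series_op_const
        unfolding series_op_def by (rule hsum_rec)
    qed (intro gc x x' sl2.const_closed x0)+
    then show ?thesis using x0 x(2) C(2) by (auto simp: bar)
  qed
  have bariso: "gbar \<psi> g \<in> ring_iso sl2.Q (Uhpsi_bar \<psi>)"
  proof -
    have "gbar \<psi> g ` carrier sl2.Q = carrier (Uhpsi_bar \<psi>)"
      using barsurj ring_hom_closed[OF barhom] by blast
    then show ?thesis using barhom barinj by (simp add: ring_iso_def bij_betw_def)
  qed
  have barsm: "gbar \<psi> g (sl2.sm c u) = Uhpsi_bar_sm \<psi> c (gbar \<psi> g u)" if u: "u \<in> carrier sl2.Q" for c u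
  proof -
    let ?C = "g (const_ser sl2.Q u)"
    have C: "?C \<in> carrier (Uhpsi \<psi>)" by (rule gc[OF sl2.const_closed[OF u]])
    \<comment> \<open>This is the representative that \<open>Uhpsi_bar_sm\<close> picks; it differs
      from \<open>?C\<close> by an element of h U_h(psi), which scalar multiplication
      preserves.\<close>
    define y where "y = (SOME y. y \<in> ?p ?C)"
    have "?C \<in> ?p ?C"
    proof -
      interpret ideal "hU \<psi>" "Uhpsi \<psi>" by (rule ideal_hU)
      show ?thesis by (rule a_rcos_self[OF C])
    qed
    then have "y \<in> ?p ?C" unfolding y_def by (rule someI[of "\<lambda>y. y \<in> ?p ?C"])
    then obtain a where a: "a \<in> hU \<psi>" "y = a \<oplus>\<^bsub>Uhpsi \<psi>\<^esub> ?C" by (auto simp: a_r_coset_def')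
    then obtain d where ac: "a \<in> carrier (Uhpsi \<psi>)" and d: "d \<in> carrier (Uhpsi \<psi>)"
      "\<And>n v k. class_op \<psi> a n v k = fps_X * class_op \<psi> d n v k" unfolding hU_iff by blast
    have "?p (Uhpsi_sm \<psi> (fps_const c) y) = ?p (g (const_ser sl2.Q (sl2.sm c u)))"
    proof (rule hU_coset_eqI)
      show "class_op \<psi> (Uhpsi_sm \<psi> (fps_const c) y) n v k = class_op \<psi> (g (const_ser sl2.Q (sl2.sm c u))) n v k
          + fps_X * class_op \<psi> (Uhpsi_sm \<psi> (fps_const c) d) n v k" for n v k
        using ac C d u unfolding a(2)
        by (simp add: class_op_smult class_op_add g sl2.const_closed sl2.sm_closed sl2.series_op_const
            sl2.coset_op_sm algebra_simps)
    qed (use ac C d u a(2) in \<open>simp_all add: class_op_smult gc sl2.const_closed sl2.sm_closed\<close>)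
    then show ?thesis unfolding Uhpsi_bar_sm_def qsmult_def bar y_def by simp
  qed
  have barstruct: "gbar \<psi> g (proj_sl2 C) = struct_bar \<psi> C" if C: "C \<in> carrier Ua" for C
  proof -
    define f where "f = (SOME f. f \<in> C)"
    obtain f0 where f0: "f0 \<in> carrier freealg" "C = Ua.cl f0"
      using C by (auto simp: Ua_def Ua.carrier_Q)
    have f: "f \<in> carrier freealg" "Ua.cl f = C"
      using Ua.some_cl[OF f0(1)] f0(2) by (simp_all add: f_def)
    \<comment> \<open>y expresses the deformed action of f inside U(sl2)[[h]]. Its constant term is
      the sl2 class of f and the rest is divisible by h, so both structural maps agree after
      reduction.\<close>
    obtain y where y: "y \<in> carrier sl2.S" "\<And>n v k. series_op sl2_col y n v k = free_op \<psi> f n v k"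
      using free_in_range[OF reg f(1)] by blast
    have y0: "y 0 = sl2.cl f" by (rule range_constant_term[OF reg f(1) y])
    have y': "(\<lambda>m. y (Suc m)) \<in> carrier sl2.S" using y(1) by (simp add: series_simps)
    have cC: "const_ser Ua C \<in> carrier Uha"
      using C unfolding Uha_def Ua_def by (rule Ua.const_closed)
    have "?p (psi_class \<psi> (const_ser Ua C)) = ?p (g (const_ser sl2.Q (sl2.cl f)))"
    proof (rule hU_coset_eqI)
      fix n v k
      have "class_op \<psi> (psi_class \<psi> (const_ser Ua C)) n v k = series_op sl2_col y n v k"
        unfolding class_op_class[OF cC] y(2)
        unfolding Ua_def Ua.series_op_const f(2)[symmetric] by (simp add: Ua.coset_op_cl f(1))
      also have "\<dots> = coset_op sl2_col (sl2.cl f) n v k + fps_X * series_op sl2_col (\<lambda>m. y (Suc m)) n v k"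
        unfolding series_op_def y0[symmetric] by (rule hsum_rec)
      finally show "class_op \<psi> (psi_class \<psi> (const_ser Ua C)) n v k
          = class_op \<psi> (g (const_ser sl2.Q (sl2.cl f))) n v k + fps_X * class_op \<psi> (g (\<lambda>m. y (Suc m))) n v k"
        by (simp add: g y' f sl2.const_closed sl2.cl_closed sl2.series_op_const)
    qed (use cC f y' in \<open>auto simp: carrier_Uhpsi[of "psi_class \<psi> (const_ser Ua C)"] intro!: gc sl2.const_closed sl2.cl_closed\<close>)
    then show ?thesis by (simp add: bar struct_bar_def proj_sl2_def f_def)
  qed
  have "b_trivialization \<psi> g"
    unfolding b_trivialization_def Usl2_eqs
    using iso smult gen bariso barsm barstruct by simp
  then show ?thesis by blast
qed

text \<open>Functions are total and unconstrained off the carrier, so uniqueness has to be read as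
  agreement on the carrier.\<close>

theorem mainTheorem10:
  fixes \<psi> :: "nat \<Rightarrow> int \<Rightarrow> 'k::field_char_0 fps"
  assumes "regular_colouring \<psi>"
  shows "b_trivial \<psi> \<and>
         (\<exists>g. b_trivialization \<psi> g \<and>
              (\<forall>g'. b_trivialization \<psi> g' \<longrightarrow> (\<forall>x\<in>carrier Usl2h. g' x = g x)))"
proof -
  obtain g where g: "b_trivialization \<psi> g" using trivialization_exists[OF assms] by blast
  have "g' x = g x" if g': "b_trivialization \<psi> g'" and x: "x \<in> carrier Usl2h" for g' x
  proof (rule class_op_inj)
    have "g \<in> ring_iso Usl2h (Uhpsi \<psi>)" "g' \<in> ring_iso Usl2h (Uhpsi \<psi>)"
      using g g' by (simp_all add: b_trivialization_def)
    then show "g' x \<in> carrier (Uhpsi \<psi>)" "g x \<in> carrier (Uhpsi \<psi>)"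
      using x by (simp_all add: ring_iso_memE(1))
    show "class_op \<psi> (g' x) n v k = class_op \<psi> (g x) n v k" for n v k
      using trivialization_determined[OF assms] g g' x by (simp add: Usl2_eqs)
  qed
  then show ?thesis using g unfolding b_trivial_def by blast
qed

end
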